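(* Let $x:[t_0,+\infty)\to\mathcal{H}$ be a solution trajectory (strong global solution) of the dynamical system $$\ddot{x}(t)+\delta\sqrt{\epsilon(t)}\,\dot{x}(t)+\frac{1}{\gamma\sqrt{\epsilon(t)}}\frac{d}{dt}\big(\mathcal{A}_{\eta}x(t)+\epsilon(t)x(t)\big)+\mathcal{A}_{\eta}x(t)+\epsilon(t)x(t)=0 .$$ Assume that $$\gamma<\delta<\gamma+\frac{\gamma}{\frac{\gamma^2}{2}+1},\qquad \epsilon^{-\frac12}(t)\,\ddot{\epsilon}(t)\le -\frac14(\delta-\gamma)\,\dot{\epsilon}(t)\quad\text{for } t\ge t_0,$$ and $$\lim_{t\to+\infty}\epsilon^{-2-\frac{1}{\gamma^2}}(t)\,\dot{\epsilon}(t)=0,\qquad \lim_{t\to+\infty}\exp\Big(\int_{t_0}^{t}\sqrt{\epsilon(s)}\,ds\Big)=+\infty .$$ Then $x(t)$ converges strongly, as $t\to+\infty$, to $x^*$, the element of minimum norm of $\operatorname{zer}\mathcal{A}$.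
   Context: $\mathcal{H}$ is a real Hilbert space. For $\mathcal{A}:\mathcal{H}\to2^{\mathcal{H}}$, $\operatorname{gra}\mathcal{A}=\{(x,u):u\in\mathcal{A}x\}$ and $\operatorname{zer}\mathcal{A}=\{x:0\in\mathcal{A}x\}$. For $\rho\in\mathbb{R}$, $\mathcal{A}$ is $\rho$-comonotone if $\langle x-y,u-v\rangle\ge\rho\|u-v\|^2$ for all $(x,u),(y,v)\in\operatorname{gra}\mathcal{A}$; it is maximally $\rho$-comonotone if moreover no $\rho$-comonotone operator has a graph properly containing $\operatorname{gra}\mathcal{A}$. For $\eta>0$, $J_\eta^{\mathcal{A}}=(Id+\eta\mathcal{A})^{-1}$ is the resolvent and $\mathcal{A}_\eta=\frac1\eta(Id-J_\eta^{\mathcal{A}})$ is the Yosida regularization. When $\mathcal{A}$ is maximally $\rho$-comonotone and $\eta>\max\{-2\rho,0\}$, both are single-valued and defined on all of $\mathcal{H}$. Standing assumptions: $\mathcal{A}:\mathcal{H}\to2^{\mathcal{H}}$ is maximally $\rho$-comonotone with $\rho\in\mathbb{R}$ and $\operatorname{zer}\mathcal{A}\ne\emptyset$; $\eta>\max\{-2\rho,0\}$; $\delta>0$, $\gamma>0$; $t_0>0$; $\epsilon:[t_0,+\infty)\to(0,+\infty)$ is nonincreasing, of class $C^1$, $\ddot\epsilon(t)$ exists, and $\lim_{t\to+\infty}\epsilon(t)=0$; $x^*$ is the element of minimum norm of $\operatorname{zer}\mathcal{A}$. A strong global solution of the system is a function $x:[t_0,+\infty)\to\mathcal{H}$ such that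 $x$ and $\dot x$ are locally absolutely continuous (absolutely continuous on each $[t_0,T]$, $t_0<T<+\infty$) and the equation holds for almost every $t\ge t_0$. *)

theory Defs
  imports "HOL-Analysis.Analysis"
begin

text \<open>
  Set-valued operators on a real Hilbert space are functions \<open>'a \<Rightarrow> 'a set\<close>, with
  \<open>'a :: {real_inner, complete_space}\<close>.
\<close>

definition gra :: "('a \<Rightarrow> 'a set) \<Rightarrow> ('a \<times> 'a) set" where
  "gra A = {(x, u). u \<in> A x}"

definition zer :: "('a::zero \<Rightarrow> 'a set) \<Rightarrow> 'a set" where
  "zer A = {x. 0 \<in> A x}"

definition comonotone :: "real \<Rightarrow> ('a::real_inner \<Rightarrow> 'a set) \<Rightarrow> bool" where
  "comonotone \<rho> A \<longleftrightarrow>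
     (\<forall>(x, u) \<in> gra A. \<forall>(y, v) \<in> gra A. (x - y) \<bullet> (u - v) \<ge> \<rho> * (norm (u - v))\<^sup>2)"

definition max_comonotone :: "real \<Rightarrow> ('a::real_inner \<Rightarrow> 'a set) \<Rightarrow> bool" where
  "max_comonotone \<rho> A \<longleftrightarrow>
     comonotone \<rho> A \<and> \<not> (\<exists>B. comonotone \<rho> B \<and> gra A \<subset> gra B)"

text \<open>
  \<open>resolvent_set \<eta> A\<close> is the set-valued inverse of \<open>Id + \<eta> A\<close>, and \<open>yosida_set \<eta> A\<close> is
  \<open>(1/\<eta>) (Id - resolvent_set \<eta> A)\<close>. The function \<open>yosida \<eta> A\<close> is meaningful where the latter
  is single-valued.
\<close>

definition resolvent_set :: "real \<Rightarrow> ('a::real_vector \<Rightarrow> 'a set) \<Rightarrow> 'a \<Rightarrow> 'a set" where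
  "resolvent_set \<eta> A x = {p. x \<in> (\<lambda>u. p + \<eta> *\<^sub>R u) ` A p}"

definition yosida_set :: "real \<Rightarrow> ('a::real_vector \<Rightarrow> 'a set) \<Rightarrow> 'a \<Rightarrow> 'a set" where
  "yosida_set \<eta> A x = (\<lambda>p. (1 / \<eta>) *\<^sub>R (x - p)) ` resolvent_set \<eta> A x"

definition yosida :: "real \<Rightarrow> ('a::real_vector \<Rightarrow> 'a set) \<Rightarrow> 'a \<Rightarrow> 'a" where
  "yosida \<eta> A x = the_elem (yosida_set \<eta> A x)"

text \<open>
  Absolute continuity on \<open>[a, b]\<close>; \<open>D\<close> is a finite set of pairs \<open>(u, v)\<close> that stand for
  pairwise disjoint open subintervals.
\<close>

definition abs_continuous_on_interval ::
    "real \<Rightarrow> real \<Rightarrow> (real \<Rightarrow> 'a::real_normed_vector) \<Rightarrow> bool" where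
  "abs_continuous_on_interval a b f \<longleftrightarrow>
     (\<forall>e>0. \<exists>d>0. \<forall>D.
        finite D \<and> (\<forall>(u, v) \<in> D. a \<le> u \<and> u < v \<and> v \<le> b) \<and>
        disjoint_family_on (\<lambda>(u, v). {u<..<v}) D \<and>
        (\<Sum>(u, v)\<in>D. v - u) < d
        \<longrightarrow> (\<Sum>(u, v)\<in>D. norm (f v - f u)) < e)"

definition loc_abs_continuous :: "real \<Rightarrow> (real \<Rightarrow> 'a::real_normed_vector) \<Rightarrow> bool" where
  "loc_abs_continuous t\<^sub>0 f \<longleftrightarrow> (\<forall>T>t\<^sub>0. abs_continuous_on_interval t\<^sub>0 T f)"

text \<open>
  A locally absolutely continuous \<open>x'\<close> is continuous, so \<open>x\<close> is \<open>C\<^sup>1\<close> and its derivative \<open>v\<close>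
  exists at every \<open>t \<ge> t\<^sub>0\<close> (one-sided at \<open>t\<^sub>0\<close>). The second derivative \<open>a\<close> of \<open>x\<close> and the
  derivative \<open>w\<close> of \<open>A\<^sub>\<eta> x + \<epsilon> x\<close> are only required at almost every \<open>t\<close>.
\<close>

definition strong_global_solution ::
    "('a::real_inner \<Rightarrow> 'a set) \<Rightarrow> real \<Rightarrow> real \<Rightarrow> real \<Rightarrow> real \<Rightarrow> (real \<Rightarrow> real) \<Rightarrow>
     (real \<Rightarrow> 'a) \<Rightarrow> bool" where
  "strong_global_solution A \<eta> \<delta> \<gamma> t\<^sub>0 \<epsilon> x \<longleftrightarrow>
     loc_abs_continuous t\<^sub>0 x \<and>
     (\<exists>v. (\<forall>t\<ge>t\<^sub>0. (x has_vector_derivative v t) (at t within {t\<^sub>0..})) \<and>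
          loc_abs_continuous t\<^sub>0 v \<and>
          (AE t in lebesgue. t \<ge> t\<^sub>0 \<longrightarrow>
             (\<exists>a w. (v has_vector_derivative a) (at t within {t\<^sub>0..}) \<and>
                    ((\<lambda>s. yosida \<eta> A (x s) + \<epsilon> s *\<^sub>R x s) has_vector_derivative w)
                      (at t within {t\<^sub>0..}) \<and>
                    a + (\<delta> * sqrt (\<epsilon> t)) *\<^sub>R v t + (1 / (\<gamma> * sqrt (\<epsilon> t))) *\<^sub>R w
                      + yosida \<eta> A (x t) + \<epsilon> t *\<^sub>R x t = 0)))"

end

theory Submission
  imports Defs
begin

text \<open>
  By a Kirszbraun-type extension the maximally comonotone \<open>A\<close> has an everywhere defined
  \<open>(\<rho> + \<eta>)\<close>-cocoercive Yosida regularization \<open>B\<close> with the same zeros. The solutions \<open>y(t)\<close> of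
  \<open>B y + \<epsilon>(t) y = 0\<close> converge to the zero of minimum norm, and \<open>\<parallel>y(s) - y(t)\<parallel>\<close> is at most a constant
  times \<open>\<bar>ln \<epsilon>(s) - ln \<epsilon>(t)\<bar>\<close>. With \<open>d = \<delta> - \<gamma>\<close>, \<open>F = B x + \<epsilon> x\<close> and
  \<open>V = x' / \<surd>\<epsilon> + F / (\<gamma> \<epsilon>)\<close>, the function
  \<open>\<Phi> = \<gamma> d / 2 \<parallel>x - y\<parallel>\<^sup>2 + 1 / 2 \<parallel>V + d (x - y)\<parallel>\<^sup>2\<close> satisfies, for every \<open>k > 0\<close> and all large \<open>t\<close>,
  \<open>\<Phi>' \<le> - c \<surd>\<epsilon> (\<Phi> - k)\<close> in the sense of upper derivates almost everywhere, so \<open>\<Phi>\<close> tends to 0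
  because the integral of \<open>\<surd>\<epsilon>\<close> diverges. The remainder terms vanish because \<open>\<epsilon>' / \<epsilon>\<^sup>2\<close> tends to 0.
\<close>

section \<open>The Yosida regularization\<close>

text \<open>The anchor is the moving point \<open>y\<close> because
  \<open>F = (B x - B y) + \<epsilon> (x - y)\<close> is then homogeneous in \<open>x - y\<close>.
  With the limit \<open>p\<close> as anchor, \<open>F\<close> would keep a summand
  \<open>\<epsilon> p\<close> whose contribution is of the same order as the decay. \<open>V\<close>
  is built so that the derivative of \<open>F\<close> drops out of its equation, hence
  \<open>B\<close> is never differentiated; the shift \<open>d (x - y)\<close> removes the damping
  part \<open>d x'\<close> that is left. The weight \<open>\<gamma> d / 2\<close> is the one for
  which the leading cross terms complete a square: with \<open>e = x - y\<close> and
  \<open>U = V + d e\<close>, the leading part of the derivative is \<open>- \<surd>\<epsilon>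
  (\<gamma> \<parallel>U - d e\<parallel>\<^sup>2 + d \<parallel>e\<parallel>\<^sup>2)\<close>,
  negative definite for all positive \<open>\<gamma>\<close> and \<open>d\<close>, next to a term
  that is nonpositive by monotonicity. All other terms carry a factor
  \<open>\<epsilon>' / \<epsilon>\<^sup>2\<close>. The obstacle is regularity: \<open>y\<close> and
  \<open>B x\<close> come only with Lipschitz estimates and \<open>x'\<close> is only absolutely
  continuous, so the decay has to be integrated from bounds on difference quotients outside a null
  set.\<close>

definition cocoercive :: "real \<Rightarrow> ('a::real_inner \<Rightarrow> 'a) \<Rightarrow> bool" where
  "cocoercive \<beta> B \<longleftrightarrow> (\<forall>z w. \<beta> * (norm (B z - B w))\<^sup>2 \<le> (z - w) \<bullet> (B z - B w))"

section \<open>Kirszbraun extension by one point\<close>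

lemma kirszbraun_point:
  fixes G :: "('a::real_inner \<times> 'b::{real_inner, complete_space}) set" and x :: 'a
  assumes nonexp: "\<And>a b a' b'. (a, b) \<in> G \<Longrightarrow> (a', b') \<in> G \<Longrightarrow> norm (b - b') \<le> norm (a - a')"
  shows "\<exists>y. \<forall>(a, b) \<in> G. norm (y - b) \<le> norm (x - a)"
proof (cases "G = {}")
  case False
  text \<open>
    The function \<open>r - \<parallel>p\<parallel>\<^sup>2\<close> is strongly concave in \<open>p\<close> on the convex hull \<open>K\<close>, so the \<open>p\<close>-components of
    a maximising sequence converge without any compactness, and first-order optimality at the limit
    bounds \<open>\<parallel>p - b\<parallel>\<^sup>2 - \<parallel>x - a\<parallel>\<^sup>2\<close> by the supremum. The third component of \<open>K\<close> only serves to
    express nonexpansiveness as \<open>Q \<le> 0\<close> on generators; being affine in each argument, \<open>Q \<le> 0\<close> extends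
    to \<open>K\<close>, and its diagonal gives \<open>r - \<parallel>p\<parallel>\<^sup>2 \<le> 0\<close>.
  \<close>
  define X where "X = (\<lambda>(a, b). (b, b \<bullet> b - (x - a) \<bullet> (x - a), x - a)) ` G"
  define K where "K = convex hull X"
  define Q :: "'b \<times> real \<times> 'a \<Rightarrow> 'b \<times> real \<times> 'a \<Rightarrow> real" where
    "Q = (\<lambda>(p, r, m) (p', r', m'). r + r' - 2 * (p \<bullet> p') + 2 * (m \<bullet> m'))"
  have Q_sym: "Q Y Z = Q Z Y" for Y Z
    by (cases Y; cases Z) (simp add: Q_def inner_commute)
  have Q_convex: "convex {Z. Q Y Z \<le> 0}" for Y
  proof -
    obtain p r m where Y: "Y = (p, r, m)" by (metis prod_cases3)
    have "{Z. Q Y Z \<le> 0} = {Z. (- 2 *\<^sub>R p, 1::real, 2 *\<^sub>R m) \<bullet> Z \<le> - r}"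
      by (auto simp: Q_def Y inner_prod_def)
    then show ?thesis by (metis convex_halfspace_le)
  qed
  have Q_gen: "Q Y Z \<le> 0" if YZ: "Y \<in> X" "Z \<in> X" for Y Z
  proof -
    obtain a b where ab: "(a, b) \<in> G" and Y: "Y = (b, b \<bullet> b - (x - a) \<bullet> (x - a), x - a)"
      using YZ(1) by (auto simp: X_def)
    obtain a' b' where ab': "(a', b') \<in> G"
      and Z: "Z = (b', b' \<bullet> b' - (x - a') \<bullet> (x - a'), x - a')"
      using YZ(2) by (auto simp: X_def)
    have "(norm (b - b'))\<^sup>2 \<le> (norm (a - a'))\<^sup>2"
      using nonexp[OF ab ab'] by (simp add: power_mono)
    then show ?thesis
      unfolding Q_def Y Z
      by (simp add: power2_norm_eq_inner inner_diff_left inner_diff_right inner_commute algebra_simps)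
  qed
  have Q_gen_hull: "Q Y Z \<le> 0" if "Y \<in> X" "Z \<in> K" for Y Z
  proof -
    have "K \<subseteq> {Z. Q Y Z \<le> 0}"
      unfolding K_def by (rule hull_minimal) (use Q_gen[OF that(1)] Q_convex in auto)
    then show ?thesis using that(2) by blast
  qed
  have Q_hull: "Q Y Z \<le> 0" if "Y \<in> K" "Z \<in> K" for Y Z
  proof -
    have "Q Y W \<le> 0" if "W \<in> X" for W
      using Q_gen_hull[OF that \<open>Y \<in> K\<close>] Q_sym[of Y W] by simp
    then have "K \<subseteq> {Z. Q Y Z \<le> 0}"
      unfolding K_def by (intro hull_minimal) (use Q_convex in auto)
    then show ?thesis using that(2) by blast
  qed
  define f :: "'b \<times> real \<times> 'a \<Rightarrow> real" where "f = (\<lambda>(p, r, m). r - p \<bullet> p)"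
  have f_le: "f Z \<le> 0" if "Z \<in> K" for Z
  proof -
    obtain p r m where Z: "Z = (p, r, m)" by (metis prod_cases3)
    have "2 * r - 2 * (p \<bullet> p) + 2 * (m \<bullet> m) \<le> 0"
      using Q_hull[OF that that] by (simp add: Q_def Z)
    moreover have "m \<bullet> m \<ge> 0" by simp
    ultimately have "r - p \<bullet> p \<le> 0" by linarith
    then show ?thesis by (simp add: f_def Z)
  qed
  have XK: "X \<subseteq> K" by (simp add: K_def hull_subset)
  have K_ne: "K \<noteq> {}" using False by (simp add: K_def X_def)
  have K_conv: "convex K" by (simp add: K_def)
  define S where "S = Sup (f ` K)"
  have bdd: "bdd_above (f ` K)" by (rule bdd_aboveI2) (rule f_le)
  have f_S: "f Z \<le> S" if "Z \<in> K" for Z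
    unfolding S_def by (rule cSUP_upper[OF that bdd])
  have S_le: "S \<le> 0"
    unfolding S_def by (intro cSUP_least K_ne f_le)
  have "\<exists>Z\<in>K. S - 1 / real (Suc n) < f Z" for n
    using less_cSUP_iff[OF K_ne bdd, of "S - 1 / real (Suc n)"] by (simp add: S_def)
  then obtain Z where ZK: "\<And>n. Z n \<in> K" and Zf: "\<And>n. S - 1 / real (Suc n) < f (Z n)"
    by metis
  define p where "p n = fst (Z n)" for n
  define r where "r n = fst (snd (Z n))" for n
  have f_Z: "f (Z n) = r n - p n \<bullet> p n" for n
    by (simp add: f_def p_def r_def split_beta)
  \<comment> \<open>The midpoint of two near-maximisers lies in \<open>K\<close>, and there
    \<open>f\<close> exceeds the mean of the two values by
    \<open>(norm (p n - p k))\<^sup>2 / 4\<close>, by the parallelogram law.\<close>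
  have close: "(norm (p n - p k))\<^sup>2 \<le> 2 / real (Suc n) + 2 / real (Suc k)" for n k
  proof -
    let ?M = "(1/2) *\<^sub>R Z n + (1/2) *\<^sub>R Z k"
    have "?M \<in> K" using K_conv ZK by (intro convexD) auto
    from f_S[OF this] have "(r n + r k) / 2 - (1/4) * ((p n + p k) \<bullet> (p n + p k)) \<le> S"
      by (simp add: f_def p_def r_def split_beta inner_add_left inner_add_right algebra_simps)
    then have "(norm (p n - p k))\<^sup>2 \<le> 4 * S - 2 * f (Z n) - 2 * f (Z k)"
      by (simp add: f_Z power2_norm_eq_inner inner_add_left inner_add_right inner_diff_left
          inner_diff_right inner_commute algebra_simps)
    then show ?thesis using Zf[of n] Zf[of k] by simp
  qed
  have "Cauchy p"
  proof (rule metric_CauchyI)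
    fix e :: real assume "e > 0"
    then obtain M where M: "inverse (real (Suc M)) < e\<^sup>2 / 4"
      using reals_Archimedean[of "e\<^sup>2 / 4"] by auto
    have "dist (p n) (p k) < e" if "n \<ge> M" "k \<ge> M" for n k
    proof -
      have "2 / real (Suc n) \<le> 2 / real (Suc M)" "2 / real (Suc k) \<le> 2 / real (Suc M)"
        using that by (auto intro!: divide_left_mono)
      then have "(norm (p n - p k))\<^sup>2 \<le> 2 / real (Suc M) + 2 / real (Suc M)"
        using close[of n k] by linarith
      also have "\<dots> = 4 * inverse (real (Suc M))" by (simp add: divide_inverse)
      also have "\<dots> < e\<^sup>2" using M by simp
      finally show ?thesis using \<open>e > 0\<close> by (simp add: dist_norm power_less_imp_less_base)
    qed
    then show "\<exists>M. \<forall>m\<ge>M. \<forall>n\<ge>M. dist (p m) (p n) < e" by blast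
  qed
  then obtain y where y: "p \<longlonglongrightarrow> y" by (meson Cauchy_convergent_iff convergent_def)
  have "norm (y - b) \<le> norm (x - a)" if ab: "(a, b) \<in> G" for a b
  proof -
    let ?g = "b \<bullet> b - (x - a) \<bullet> (x - a)"
    have gX: "(b, ?g, x - a) \<in> K" using ab XK by (force simp: X_def)
    \<comment> \<open>Maximality is tested on the segment from \<open>Z n\<close> to a generator,
      where strong concavity leaves the excess
      \<open>s * (1 - s) * ((y - b) \<bullet> (y - b))\<close>. Replacing \<open>r n\<close> by its
      lower bound lets \<open>n\<close> tend to infinity using the convergence of \<open>p\<close>
      alone; division by \<open>s\<close> follows.\<close>
    have step: "(1 - s) * ((y - b) \<bullet> (y - b)) \<le> (x - a) \<bullet> (x - a)" if s: "0 < s" "s \<le> 1" for s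
    proof -
      have n: "(1 - s) * (S - 1 / real (Suc n) + p n \<bullet> p n) + s * ?g
          - ((1 - s) *\<^sub>R p n + s *\<^sub>R b) \<bullet> ((1 - s) *\<^sub>R p n + s *\<^sub>R b) \<le> S" for n
      proof -
        let ?M = "(1 - s) *\<^sub>R Z n + s *\<^sub>R (b, ?g, x - a)"
        have "?M \<in> K" using K_conv ZK gX s by (intro convexD) auto
        from f_S[OF this] have "(1 - s) * r n + s * ?g
            - ((1 - s) *\<^sub>R p n + s *\<^sub>R b) \<bullet> ((1 - s) *\<^sub>R p n + s *\<^sub>R b) \<le> S"
          by (simp add: f_def p_def r_def split_beta)
        moreover have "(1 - s) * (S - 1 / real (Suc n) + p n \<bullet> p n) \<le> (1 - s) * r n"
          using Zf[of n] s f_Z[of n] by (intro mult_left_mono) auto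
        ultimately show ?thesis by linarith
      qed
      have "(\<lambda>n. (1 - s) * (S - 1 / real (Suc n) + p n \<bullet> p n) + s * ?g
          - ((1 - s) *\<^sub>R p n + s *\<^sub>R b) \<bullet> ((1 - s) *\<^sub>R p n + s *\<^sub>R b))
          \<longlonglongrightarrow> (1 - s) * (S - 0 + y \<bullet> y) + s * ?g
          - ((1 - s) *\<^sub>R y + s *\<^sub>R b) \<bullet> ((1 - s) *\<^sub>R y + s *\<^sub>R b)"
        using LIMSEQ_inverse_real_of_nat y
        by (intro tendsto_intros) (simp_all add: divide_inverse)
      then have "(1 - s) * (S - 0 + y \<bullet> y) + s * ?g
          - ((1 - s) *\<^sub>R y + s *\<^sub>R b) \<bullet> ((1 - s) *\<^sub>R y + s *\<^sub>R b) \<le> S"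
        by (rule LIMSEQ_le_const2) (use n in auto)
      then have "s * ((1 - s) * ((y - b) \<bullet> (y - b)) - (x - a) \<bullet> (x - a) - S) \<le> 0"
        by (simp add: inner_add_left inner_add_right inner_diff_left inner_diff_right
            inner_commute algebra_simps)
      then have "(1 - s) * ((y - b) \<bullet> (y - b)) - (x - a) \<bullet> (x - a) - S \<le> 0"
        using s by (simp add: mult_le_0_iff)
      then show ?thesis using S_le by linarith
    qed
    have "((\<lambda>s. (1 - s) * ((y - b) \<bullet> (y - b))) \<longlongrightarrow> (1 - 0) * ((y - b) \<bullet> (y - b))) (at_right (0::real))"
      by (intro tendsto_intros)
    then have "(1 - 0) * ((y - b) \<bullet> (y - b)) \<le> (x - a) \<bullet> (x - a)"
      by (rule tendsto_upperbound)
        (use step in \<open>auto simp: eventually_at_right_field intro!: exI[of _ 1]\<close>)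
    then show ?thesis by (simp add: norm_le)
  qed
  then show ?thesis by blast
qed auto

text \<open>The squared norms on the right differ by \<open>4 * \<beta>\<close> times the defect on
  the left. This reflection makes Kirszbraun's extension applicable to cocoercive graphs.\<close>

lemma cocoercive_pair_iff_nonexpansive:
  fixes z w u v :: "'a::real_inner"
  assumes "\<beta> > 0"
  shows "\<beta> * (norm (u - v))\<^sup>2 \<le> (z - w) \<bullet> (u - v) \<longleftrightarrow>
    norm ((z - (2 * \<beta>) *\<^sub>R u) - (w - (2 * \<beta>) *\<^sub>R v)) \<le> norm (z - w)"
proof -
  have eq: "(z - (2 * \<beta>) *\<^sub>R u) - (w - (2 * \<beta>) *\<^sub>R v) = (z - w) - (2 * \<beta>) *\<^sub>R (u - v)"
    by (simp add: algebra_simps)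
  have "norm ((z - w) - (2 * \<beta>) *\<^sub>R (u - v)) \<le> norm (z - w) \<longleftrightarrow>
    ((z - w) - (2 * \<beta>) *\<^sub>R (u - v)) \<bullet> ((z - w) - (2 * \<beta>) *\<^sub>R (u - v)) \<le> (z - w) \<bullet> (z - w)"
    by (rule norm_le)
  also have "\<dots> \<longleftrightarrow> (4 * \<beta>) * (\<beta> * ((u - v) \<bullet> (u - v))) \<le> (4 * \<beta>) * ((z - w) \<bullet> (u - v))"
    by (simp add: inner_diff_left inner_diff_right inner_commute algebra_simps)
  also have "\<dots> \<longleftrightarrow> \<beta> * ((u - v) \<bullet> (u - v)) \<le> (z - w) \<bullet> (u - v)"
    using assms by simp
  finally show ?thesis by (simp add: eq power2_norm_eq_inner)
qed

text \<open>Minty's change of variables: adding \<open>\<eta> * (norm (u - v))\<^sup>2\<close> to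
  both sides replaces \<open>p\<close> by \<open>p + \<eta> *\<^sub>R u\<close>, the point at which
  \<open>u\<close> will be the Yosida value.\<close>

lemma comonotone_iff_cocoercive_pair:
  fixes p q u v :: "'a::real_inner"
  shows "\<rho> * (norm (u - v))\<^sup>2 \<le> (p - q) \<bullet> (u - v) \<longleftrightarrow>
    (\<rho> + \<eta>) * (norm (u - v))\<^sup>2 \<le> ((p + \<eta> *\<^sub>R u) - (q + \<eta> *\<^sub>R v)) \<bullet> (u - v)"
proof -
  have "((p + \<eta> *\<^sub>R u) - (q + \<eta> *\<^sub>R v)) = (p - q) + \<eta> *\<^sub>R (u - v)"
    by (simp add: algebra_simps)
  then show ?thesis
    by (simp add: inner_add_left power2_norm_eq_inner algebra_simps)
qed

lemma comonotoneD:
  assumes "comonotone \<rho> A" "u \<in> A p" "v \<in> A q"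
  shows "\<rho> * (norm (u - v))\<^sup>2 \<le> (p - q) \<bullet> (u - v)"
  using assms by (auto simp: comonotone_def gra_def)

text \<open>Minty's surjectivity argument: extending the reflected graph to the point
  \<open>z\<close> yields a pair compatible with all of \<open>A\<close>, and maximality forces that
  pair into the graph.\<close>

lemma max_comonotone_resolvent_exists:
  fixes A :: "'a::{real_inner, complete_space} \<Rightarrow> 'a set"
  assumes "max_comonotone \<rho> A" "\<rho> + \<eta> > 0"
  shows "\<exists>u. u \<in> A (z - \<eta> *\<^sub>R u)"
proof -
  define \<beta> where "\<beta> = \<rho> + \<eta>"
  have \<beta>: "\<beta> > 0" using assms by (simp add: \<beta>_def)
  have com: "comonotone \<rho> A" using assms by (simp add: max_comonotone_def)
  define G where "G = {(p + \<eta> *\<^sub>R u, p + \<eta> *\<^sub>R u - (2 * \<beta>) *\<^sub>R u) | p u. u \<in> A p}"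
  have "\<exists>y. \<forall>(a, b)\<in>G. norm (y - b) \<le> norm (z - a)"
  proof (rule kirszbraun_point)
    fix a b a' b' assume "(a, b) \<in> G" "(a', b') \<in> G"
    then show "norm (b - b') \<le> norm (a - a')"
      using comonotoneD[OF com] cocoercive_pair_iff_nonexpansive[OF \<beta>]
        comonotone_iff_cocoercive_pair[of \<rho> _ _ _ _ \<eta>]
      unfolding G_def \<beta>_def by blast
  qed
  then obtain y where y: "\<And>a b. (a, b) \<in> G \<Longrightarrow> norm (y - b) \<le> norm (z - a)" by blast
  \<comment> \<open>Undoes the reflection, \<open>y = z - (2 * \<beta>) *\<^sub>R u\<close>, and
    then Minty's change of variables, \<open>z = p + \<eta> *\<^sub>R u\<close>.\<close>
  define u where "u = (1 / (2 * \<beta>)) *\<^sub>R (z - y)"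
  define p where "p = z - \<eta> *\<^sub>R u"
  have y_eq: "y = z - (2 * \<beta>) *\<^sub>R u" using \<beta> by (simp add: u_def)
  have new: "\<rho> * (norm (u - v))\<^sup>2 \<le> (p - q) \<bullet> (u - v)" if "v \<in> A q" for q v
  proof -
    have "(q + \<eta> *\<^sub>R v, q + \<eta> *\<^sub>R v - (2 * \<beta>) *\<^sub>R v) \<in> G" using that by (auto simp: G_def)
    from y[OF this] have "(\<rho> + \<eta>) * (norm (u - v))\<^sup>2 \<le> ((p + \<eta> *\<^sub>R u) - (q + \<eta> *\<^sub>R v)) \<bullet> (u - v)"
      unfolding y_eq cocoercive_pair_iff_nonexpansive[OF \<beta>, symmetric]
      by (simp add: p_def \<beta>_def)
    then show ?thesis by (simp only: comonotone_iff_cocoercive_pair[of \<rho> u v p q \<eta>])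
  qed
  have new': "\<rho> * (norm (v - u))\<^sup>2 \<le> (q - p) \<bullet> (v - u)" if "v \<in> A q" for q v
    using new[OF that] by (simp add: norm_minus_commute inner_diff_left inner_diff_right)
  define A' where "A' = A(p := insert u (A p))"
  have gra': "gra A' = insert (p, u) (gra A)"
    by (auto simp: gra_def A'_def split: if_splits)
  have "comonotone \<rho> A'"
    using com new new' unfolding comonotone_def gra' by (auto simp: gra_def)
  then have "\<not> gra A \<subset> gra A'"
    using assms(1) by (auto simp: max_comonotone_def)
  then have "(p, u) \<in> gra A" unfolding gra' by blast
  then have "u \<in> A p" by (simp add: gra_def)
  then show ?thesis by (auto simp: p_def)
qed

text \<open>Two candidate values at the same \<open>z\<close> share the transformed point, so
  cocoercivity gives \<open>(\<rho> + \<eta>) * (norm (u - v))\<^sup>2 \<le> 0\<close>. The value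
  set is a singleton and \<open>the_elem\<close> is determined.\<close>

lemma yosida_eqI:
  fixes A :: "'a::{real_inner, complete_space} \<Rightarrow> 'a set"
  assumes "comonotone \<rho> A" "\<rho> + \<eta> > 0" "\<eta> > 0" "u \<in> A (z - \<eta> *\<^sub>R u)"
  shows "yosida \<eta> A z = u"
proof -
  have uniq: "v = u" if "v \<in> A p" "z = p + \<eta> *\<^sub>R v" for v p
  proof -
    have "\<rho> * (norm (u - v))\<^sup>2 \<le> ((z - \<eta> *\<^sub>R u) - p) \<bullet> (u - v)"
      using comonotoneD assms(1,4) that(1) by blast
    then have "(\<rho> + \<eta>) * (norm (u - v))\<^sup>2 \<le> 0"
      by (subst (asm) comonotone_iff_cocoercive_pair[where \<eta> = \<eta>]) (simp add: that(2))
    then show ?thesis using assms(2) by (simp add: mult_le_0_iff)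
  qed
  have "p = z - \<eta> *\<^sub>R u" if "v \<in> A p" "z = p + \<eta> *\<^sub>R v" for v p
    using that uniq[OF that] by simp
  moreover have "z - \<eta> *\<^sub>R u \<in> resolvent_set \<eta> A z"
    unfolding resolvent_set_def mem_Collect_eq using assms(4) by (intro image_eqI[of _ _ u]) simp_all
  ultimately have "resolvent_set \<eta> A z = {z - \<eta> *\<^sub>R u}"
    unfolding resolvent_set_def by blast
  then have "yosida_set \<eta> A z = {u}" using assms(3) by (simp add: yosida_set_def)
  then show ?thesis by (simp add: yosida_def)
qed

lemma yosida_mem:
  fixes A :: "'a::{real_inner, complete_space} \<Rightarrow> 'a set"
  assumes "max_comonotone \<rho> A" "\<rho> + \<eta> > 0" "\<eta> > 0"
  shows "yosida \<eta> A z \<in> A (z - \<eta> *\<^sub>R yosida \<eta> A z)"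
  using max_comonotone_resolvent_exists[OF assms(1,2), of z] yosida_eqI[of \<rho> A \<eta>] assms
  by (auto simp: max_comonotone_def)

lemma yosida_cocoercive:
  fixes A :: "'a::{real_inner, complete_space} \<Rightarrow> 'a set"
  assumes "max_comonotone \<rho> A" "\<rho> + \<eta> > 0" "\<eta> > 0"
  shows "cocoercive (\<rho> + \<eta>) (yosida \<eta> A)"
  unfolding cocoercive_def
proof (intro allI)
  fix z w
  have com: "comonotone \<rho> A" using assms by (simp add: max_comonotone_def)
  show "(\<rho> + \<eta>) * (norm (yosida \<eta> A z - yosida \<eta> A w))\<^sup>2
      \<le> (z - w) \<bullet> (yosida \<eta> A z - yosida \<eta> A w)"
    using comonotoneD[OF com yosida_mem[OF assms, of z] yosida_mem[OF assms, of w]]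
    by (subst (asm) comonotone_iff_cocoercive_pair[where \<eta> = \<eta>]) simp
qed

lemma zer_eq_yosida_zero:
  fixes A :: "'a::{real_inner, complete_space} \<Rightarrow> 'a set"
  assumes "max_comonotone \<rho> A" "\<rho> + \<eta> > 0" "\<eta> > 0"
  shows "zer A = {z. yosida \<eta> A z = 0}"
proof -
  have "yosida \<eta> A z = 0" if "0 \<in> A z" for z
    using yosida_eqI[of \<rho> A \<eta> 0 z] assms that by (simp add: max_comonotone_def)
  moreover have "0 \<in> A z" if "yosida \<eta> A z = 0" for z
    using yosida_mem[OF assms, of z] that by simp
  ultimately show ?thesis by (auto simp: zer_def)
qed

section \<open>The Tikhonov curve\<close>

lemma cocoercive_monotone:
  assumes "cocoercive \<beta> B" "\<beta> > 0"
  shows "0 \<le> (z - w) \<bullet> (B z - B w)"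
proof -
  have "0 \<le> \<beta> * (norm (B z - B w))\<^sup>2" using assms(2) by simp
  also have "\<dots> \<le> (z - w) \<bullet> (B z - B w)" using assms(1) by (simp add: cocoercive_def)
  finally show ?thesis .
qed

lemma cocoercive_lipschitz:
  assumes "cocoercive \<beta> B" "\<beta> > 0"
  shows "norm (B z - B w) \<le> (1 / \<beta>) * norm (z - w)"
proof (cases "B z = B w")
  case False
  have "\<beta> * (norm (B z - B w))\<^sup>2 \<le> norm (z - w) * norm (B z - B w)"
    using assms(1) norm_cauchy_schwarz order_trans by (fastforce simp: cocoercive_def)
  then have "\<beta> * norm (B z - B w) \<le> norm (z - w)"
    using False by (simp add: power2_eq_square mult.assoc[symmetric])
  then show ?thesis using assms(2) by (simp add: field_simps)
qed (use assms(2) in simp)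

text \<open>Multiplied by \<open>2 * \<beta>\<close>, the equation says that
  \<open>(1 + 2 * \<beta> * e) *\<^sub>R y\<close> equals the reflection
  \<open>y - (2 * \<beta>) *\<^sub>R B y\<close>. The reflection is nonexpansive, so Banach's
  theorem applies with factor \<open>c\<close>.\<close>

lemma tikhonov_exists:
  fixes B :: "'a::{real_inner, complete_space} \<Rightarrow> 'a"
  assumes "cocoercive \<beta> B" "\<beta> > 0" "e > 0"
  shows "\<exists>y. B y + e *\<^sub>R y = 0"
proof -
  define c where "c = 1 / (1 + 2 * \<beta> * e)"
  have be: "2 * \<beta> * e > 0" using assms by simp
  have c: "0 \<le> c" "c < 1" using be by (auto simp: c_def)
  define f where "f y = c *\<^sub>R (y - (2 * \<beta>) *\<^sub>R B y)" for y
  have "dist (f y) (f z) \<le> c * dist y z" for y z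
  proof -
    have "f y - f z = c *\<^sub>R ((y - (2 * \<beta>) *\<^sub>R B y) - (z - (2 * \<beta>) *\<^sub>R B z))"
      by (simp add: f_def scaleR_diff_right)
    moreover have "norm ((y - (2 * \<beta>) *\<^sub>R B y) - (z - (2 * \<beta>) *\<^sub>R B z)) \<le> norm (y - z)"
      using assms(1) unfolding cocoercive_pair_iff_nonexpansive[OF assms(2), symmetric]
      by (simp add: cocoercive_def)
    ultimately show ?thesis using c by (simp add: dist_norm mult_left_mono)
  qed
  then have "\<exists>!y. f y = y"
    using banach_fix_type[OF c, of f] by blast
  then obtain y where y: "f y = y" by blast
  have "(1 + 2 * \<beta> * e) *\<^sub>R y = (1 + 2 * \<beta> * e) *\<^sub>R f y" by (simp add: y)
  also have "\<dots> = y - (2 * \<beta>) *\<^sub>R B y" using be by (simp add: f_def c_def)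
  finally have "(2 * \<beta>) *\<^sub>R (B y + e *\<^sub>R y) = 0" by (simp add: algebra_simps)
  then show ?thesis using assms(2) by auto
qed

definition tikhonov :: "('a::real_vector \<Rightarrow> 'a) \<Rightarrow> real \<Rightarrow> 'a" where
  "tikhonov B e = (SOME y. B y + e *\<^sub>R y = 0)"

lemma tikhonov_eq:
  fixes B :: "'a::{real_inner, complete_space} \<Rightarrow> 'a"
  assumes "cocoercive \<beta> B" "\<beta> > 0" "e > 0"
  shows "B (tikhonov B e) = - (e *\<^sub>R tikhonov B e)"
  using someI_ex[OF tikhonov_exists[OF assms]] by (simp add: tikhonov_def eq_neg_iff_add_eq_0)

text \<open>Monotonicity of \<open>B\<close> tested on two points of the curve. The value
  \<open>e' = 0\<close> is allowed and makes \<open>y'\<close> any zero of \<open>B\<close>, so one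
  inequality yields both the bounds by zeros and the modulus of continuity.\<close>

lemma tikhonov_pair:
  assumes "cocoercive \<beta> B" "\<beta> > 0" "B y = - (e *\<^sub>R y)" "B y' = - (e' *\<^sub>R y')"
  shows "e * (norm (y - y'))\<^sup>2 \<le> (e - e') * (y' \<bullet> (y' - y))"
proof -
  have "0 \<le> (y - y') \<bullet> (B y - B y')" by (rule cocoercive_monotone[OF assms(1,2)])
  then show ?thesis unfolding assms(3,4)
    by (simp add: power2_norm_eq_inner inner_diff_left inner_diff_right inner_commute algebra_simps)
qed

context
  fixes B :: "'a::{real_inner, complete_space} \<Rightarrow> 'a" and \<beta> :: real
  assumes coco: "cocoercive \<beta> B" and \<beta>_pos: "\<beta> > 0"
begin

lemma tikhonov_inner_le:
  assumes "e > 0" "B z = 0"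
  shows "(norm (tikhonov B e))\<^sup>2 \<le> z \<bullet> tikhonov B e"
proof -
  have "e * (norm (tikhonov B e - z))\<^sup>2 \<le> (e - 0) * (z \<bullet> (z - tikhonov B e))"
    by (rule tikhonov_pair[OF coco \<beta>_pos tikhonov_eq[OF coco \<beta>_pos assms(1)]])
      (simp add: assms(2))
  then have "(norm (tikhonov B e - z))\<^sup>2 \<le> z \<bullet> (z - tikhonov B e)"
    using assms(1) by simp
  then show ?thesis
    by (simp add: power2_norm_eq_inner inner_diff_left inner_diff_right inner_commute)
qed

lemma norm_tikhonov_le:
  assumes "e > 0" "B z = 0"
  shows "norm (tikhonov B e) \<le> norm z"
proof -
  have "(norm (tikhonov B e))\<^sup>2 \<le> norm z * norm (tikhonov B e)"
    using tikhonov_inner_le[OF assms] norm_cauchy_schwarz order_trans by blast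
  then show ?thesis
    by (cases "tikhonov B e = 0") (simp_all add: power2_eq_square)
qed

text \<open>Cauchy-Schwarz in the pair inequality gives the factor \<open>1 - e' / e\<close>, and
  \<open>ln s \<le> s - 1\<close> bounds it. Along \<open>\<epsilon>\<close> the curve thus moves at
  a rate of at most a constant times \<open>\<bar>\<epsilon>' / \<epsilon>\<bar>\<close>.\<close>

lemma tikhonov_dist_le_ratio:
  assumes "0 < e'" "e' \<le> e" "B z = 0"
  shows "norm (tikhonov B e - tikhonov B e') \<le> (ln e - ln e') * norm z"
proof -
  let ?y = "tikhonov B e" and ?y' = "tikhonov B e'"
  have e: "e > 0" using assms by linarith
  have "e * (norm (?y - ?y'))\<^sup>2 \<le> (e - e') * (?y' \<bullet> (?y' - ?y))"
    using tikhonov_pair[OF coco \<beta>_pos] tikhonov_eq[OF coco \<beta>_pos] assms(1) e by blast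
  also have "\<dots> \<le> (e - e') * (norm ?y' * norm (?y - ?y'))"
    using assms(2) norm_cauchy_schwarz[of ?y' "?y' - ?y"]
    by (intro mult_left_mono) (auto simp: norm_minus_commute)
  finally have "norm (?y - ?y') * (e * norm (?y - ?y')) \<le> norm (?y - ?y') * ((e - e') * norm ?y')"
    by (simp add: power2_eq_square algebra_simps)
  then have "e * norm (?y - ?y') \<le> (e - e') * norm ?y'"
    using assms(2) by (cases "?y = ?y'") simp_all
  then have "norm (?y - ?y') \<le> (1 - e' / e) * norm ?y'"
    using e by (simp add: field_simps)
  also have "\<dots> \<le> (1 - e' / e) * norm z"
    using norm_tikhonov_le[OF assms(1,3)] assms(2) e by (intro mult_left_mono) auto
  also have "\<dots> \<le> (ln e - ln e') * norm z"
    using ln_le_minus_one[of "e' / e"] assms(1) e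
    by (intro mult_right_mono) (auto simp: ln_div)
  finally show ?thesis .
qed

text \<open>The pair inequality with the roles exchanged gives
  \<open>y \<bullet> (y - y') \<le> 0\<close>. Increments of the squared norm then dominate squared
  distances, so bounded norms make the curve Cauchy without compactness.\<close>

lemma tikhonov_dist_le_norm:
  assumes "0 < e'" "e' \<le> e"
  shows "(norm (tikhonov B e - tikhonov B e'))\<^sup>2
    \<le> (norm (tikhonov B e'))\<^sup>2 - (norm (tikhonov B e))\<^sup>2"
proof (cases "e = e'")
  case False
  let ?y = "tikhonov B e" and ?y' = "tikhonov B e'"
  have e: "e > 0" using assms by linarith
  have "0 \<le> e' * (norm (?y' - ?y))\<^sup>2" using assms by simp
  also have "\<dots> \<le> (e' - e) * (?y \<bullet> (?y - ?y'))"
    using tikhonov_pair[OF coco \<beta>_pos] tikhonov_eq[OF coco \<beta>_pos] assms(1) e by blast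
  finally have "?y \<bullet> (?y - ?y') \<le> 0"
    using assms(2) False by (simp add: zero_le_mult_iff)
  then show ?thesis
    by (simp add: power2_norm_eq_inner inner_diff_left inner_diff_right inner_commute)
qed simp

text \<open>The squared norms grow as \<open>e\<close> decreases and are bounded by that of any
  zero. Near their supremum \<open>L\<close> the curve hardly moves, which gives convergence in norm
  directly.\<close>

lemma tikhonov_tendsto_min_norm:
  assumes "B z\<^sub>0 = 0"
  shows "(tikhonov B \<longlongrightarrow> (ARG_MIN norm z. B z = 0)) (at_right 0)"
proof -
  define n2 where "n2 e = (norm (tikhonov B e))\<^sup>2" for e
  define L where "L = Sup (n2 ` {0<..})"
  have "n2 e \<le> (norm z\<^sub>0)\<^sup>2" if "e > 0" for e
    using norm_tikhonov_le[OF that assms] by (simp add: n2_def power_mono)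
  then have bdd: "bdd_above (n2 ` {0<..})" by (intro bdd_aboveI2) auto
  have n2_L: "n2 e \<le> L" if "e > 0" for e
    unfolding L_def by (rule cSUP_upper[OF _ bdd]) (use that in simp)
  have near_L: "\<exists>e>0. L - d < n2 e" if "d > 0" for d
    using less_cSUP_iff[of "{0<..}" n2 "L - d", OF _ bdd] that
    by (auto simp: L_def)
  have near: "(norm (tikhonov B e - tikhonov B e'))\<^sup>2 < d"
    if "0 < e'" "e' \<le> e" "L - d < n2 e" for e e' d
    using tikhonov_dist_le_norm[OF that(1,2)] n2_L[OF that(1)] that(3) by (simp add: n2_def)
  have "\<exists>e. d > 0 \<longrightarrow> e > 0 \<and>
      (\<forall>e'. 0 < e' \<and> e' \<le> e \<longrightarrow> norm (tikhonov B e - tikhonov B e') < d)" for d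
  proof (cases "d > 0")
    case True
    obtain e where e: "e > 0" "L - d\<^sup>2 < n2 e" using near_L[of "d\<^sup>2"] True by auto
    have "norm (tikhonov B e - tikhonov B e') < d" if "0 < e'" "e' \<le> e" for e'
      using near[OF that e(2)] True by (auto intro: power2_less_imp_less)
    then show ?thesis using e(1) by blast
  qed simp
  then have "\<forall>d. \<exists>e. d > 0 \<longrightarrow> e > 0 \<and>
      (\<forall>e'. 0 < e' \<and> e' \<le> e \<longrightarrow> norm (tikhonov B e - tikhonov B e') < d)" by blast
  from choice[OF this] obtain E where E: "\<And>d. d > 0 \<Longrightarrow> E d > 0"
    "\<And>d e'. \<lbrakk>d > 0; 0 < e'; e' \<le> E d\<rbrakk> \<Longrightarrow> norm (tikhonov B (E d) - tikhonov B e') < d"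
    by blast
  have close: "dist (tikhonov B e) (tikhonov B e') < d"
    if "d > 0" "0 < e" "e \<le> E (d/2)" "0 < e'" "e' \<le> E (d/2)" for d e e'
    using E(2)[of "d/2" e] E(2)[of "d/2" e'] that
      dist_triangle3[of "tikhonov B e" "tikhonov B e'" "tikhonov B (E (d/2))"]
    by (simp add: dist_norm)
  \<comment> \<open>The limit is found along a sequence, where completeness applies, and then
    transferred to the whole curve by the modulus \<open>E\<close>.\<close>
  define s where "s n = inverse (real (Suc n))" for n
  have s: "s n > 0" for n by (simp add: s_def)
  have s0: "s \<longlonglongrightarrow> 0" unfolding s_def by (rule LIMSEQ_inverse_real_of_nat)
  have s_small: "\<exists>M. \<forall>n\<ge>M. s n \<le> c" if "c > 0" for c
    using order_tendstoD(2)[OF s0 that] unfolding eventually_sequentially by (meson less_imp_le)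
  have "Cauchy (\<lambda>n. tikhonov B (s n))"
  proof (rule metric_CauchyI)
    fix d :: real assume d: "d > 0"
    then obtain M where "\<forall>n\<ge>M. s n \<le> E (d/2)" using s_small[of "E (d/2)"] E(1)[of "d/2"] by auto
    then show "\<exists>M. \<forall>m\<ge>M. \<forall>n\<ge>M. dist (tikhonov B (s m)) (tikhonov B (s n)) < d"
      using close d s by blast
  qed
  then obtain p where p: "(\<lambda>n. tikhonov B (s n)) \<longlonglongrightarrow> p"
    by (meson Cauchy_convergent_iff convergent_def)
  have lim: "(tikhonov B \<longlongrightarrow> p) (at_right 0)"
  proof (rule tendstoI)
    fix d :: real assume d: "d > 0"
    have "dist (tikhonov B e) p < d" if e: "0 < e" "e < E (d/2/2)" for e
    proof -
      obtain M where M: "\<forall>n\<ge>M. s n \<le> E (d/2/2)"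
        using s_small[of "E (d/2/2)"] E(1)[of "d/2/2"] d by auto
      have "dist (tikhonov B e) p \<le> d/2"
      proof (rule LIMSEQ_le_const2)
        show "(\<lambda>n. dist (tikhonov B e) (tikhonov B (s n))) \<longlonglongrightarrow> dist (tikhonov B e) p"
          by (intro tendsto_intros p)
        show "\<exists>N. \<forall>n\<ge>N. dist (tikhonov B e) (tikhonov B (s n)) \<le> d/2"
          using close[of "d/2" e] M s e d by (intro exI[of _ M]) (auto intro: less_imp_le)
      qed
      then show ?thesis using d by linarith
    qed
    then show "\<forall>\<^sub>F e in at_right 0. dist (tikhonov B e) p < d"
      using E(1)[of "d/2/2"] d unfolding eventually_at_right_field by auto
  qed
  have zero: "B p = 0"
  proof -
    have "(\<lambda>n. B (tikhonov B (s n))) \<longlonglongrightarrow> B p"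
    proof (rule Lim_transform_bound[THEN LIM_zero_cancel])
      show "\<forall>\<^sub>F n in sequentially. norm (B (tikhonov B (s n)) - B p)
          \<le> norm ((1/\<beta>) * norm (tikhonov B (s n) - p))"
        using cocoercive_lipschitz[OF coco \<beta>_pos] \<beta>_pos by simp
      show "(\<lambda>n. (1/\<beta>) * norm (tikhonov B (s n) - p)) \<longlonglongrightarrow> 0"
        using p by (intro tendsto_mult_right_zero tendsto_norm_zero LIM_zero)
    qed
    moreover have "(\<lambda>n. - (s n *\<^sub>R tikhonov B (s n))) \<longlonglongrightarrow> - (0 *\<^sub>R p)"
      by (intro tendsto_intros s0 p)
    ultimately show ?thesis
      unfolding tikhonov_eq[OF coco \<beta>_pos s] using LIMSEQ_unique by fastforce
  qed
  have pz: "(norm p)\<^sup>2 \<le> z \<bullet> p" if "B z = 0" for z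
  proof (rule LIMSEQ_le)
    show "(\<lambda>n. (norm (tikhonov B (s n)))\<^sup>2) \<longlonglongrightarrow> (norm p)\<^sup>2" by (intro tendsto_intros p)
    show "(\<lambda>n. z \<bullet> tikhonov B (s n)) \<longlonglongrightarrow> z \<bullet> p" by (intro tendsto_intros p)
  qed (use tikhonov_inner_le[OF s that] in auto)
  \<comment> \<open>The variational inequality \<open>pz\<close> characterises \<open>p\<close> as
    the projection of 0 onto the zero set. This form gives minimality and uniqueness at once;
    uniqueness identifies the choice made by \<open>ARG_MIN\<close>.\<close>
  have uniq: "(norm (z - p))\<^sup>2 \<le> (norm z)\<^sup>2 - (norm p)\<^sup>2" if "B z = 0" for z
    using pz[OF that]
    by (simp add: power2_norm_eq_inner inner_diff_left inner_diff_right inner_commute)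
  have min: "norm p \<le> norm z" if "B z = 0" for z
  proof -
    have "(norm p)\<^sup>2 \<le> (norm z)\<^sup>2"
      using uniq[OF that] zero_le_power2[of "norm (z - p)"] by linarith
    then show ?thesis by (simp add: power_mono_iff)
  qed
  have "(ARG_MIN norm z. B z = 0) = p"
  proof (rule arg_minI[where P = "\<lambda>z. B z = 0"])
    show "B p = 0" by (rule zero)
    show "\<not> norm z < norm p" if "B z = 0" for z using min[OF that] by simp
    show "z = p" if "B z = 0" "\<forall>w. B w = 0 \<longrightarrow> \<not> norm w < norm z" for z
    proof -
      have "norm z \<le> norm p" using that(2) zero by force
      then have "(norm z)\<^sup>2 \<le> (norm p)\<^sup>2" by (simp add: power_mono)
      then have "(norm (z - p))\<^sup>2 \<le> 0" using uniq[OF that(1)] by linarith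
      then show ?thesis by simp
    qed
  qed
  then show ?thesis using lim by simp
qed

end

section \<open>Comparison for absolutely continuous functions\<close>

text \<open>
  Functions dominated by an absolutely continuous \<open>h\<close> form an algebra, which spares the closure
  properties of absolute continuity itself.
\<close>

definition dominated_on :: "(real \<Rightarrow> 'h::real_normed_vector) \<Rightarrow> real set \<Rightarrow>
    (real \<Rightarrow> 'a::real_normed_vector) \<Rightarrow> bool" where
  "dominated_on h S f \<longleftrightarrow> bounded (f ` S) \<and>
    (\<exists>C\<ge>0. \<forall>u\<in>S. \<forall>v\<in>S. norm (f v - f u) \<le> C * (norm (h v - h u) + \<bar>v - u\<bar>))"

lemma dominated_onE:
  assumes "dominated_on h S f"
  obtains C M where "C \<ge> 0" "M \<ge> 0"
    "\<And>u v. u \<in> S \<Longrightarrow> v \<in> S \<Longrightarrow> norm (f v - f u) \<le> C * (norm (h v - h u) + \<bar>v - u\<bar>)"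
    "\<And>u. u \<in> S \<Longrightarrow> norm (f u) \<le> M"
proof -
  obtain M where "\<And>u. u \<in> S \<Longrightarrow> norm (f u) \<le> M" "M > 0"
    using assms unfolding dominated_on_def bounded_pos by auto
  moreover obtain C where "C \<ge> 0"
    "\<And>u v. u \<in> S \<Longrightarrow> v \<in> S \<Longrightarrow> norm (f v - f u) \<le> C * (norm (h v - h u) + \<bar>v - u\<bar>)"
    using assms unfolding dominated_on_def by auto
  ultimately show thesis using that[of C M] by auto
qed

lemma dominated_onI:
  assumes "C \<ge> 0"
    "\<And>u v. u \<in> S \<Longrightarrow> v \<in> S \<Longrightarrow> norm (f v - f u) \<le> C * (norm (h v - h u) + \<bar>v - u\<bar>)"
    "\<And>u. u \<in> S \<Longrightarrow> norm (f u) \<le> M"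
  shows "dominated_on h S f"
  using assms unfolding dominated_on_def bounded_iff by blast

text \<open>Covers scalar multiples, products and inner products together. The product estimate is
  what requires boundedness in \<open>dominated_on\<close>.\<close>

lemma dominated_on_bilinear:
  assumes "bounded_bilinear pr" "dominated_on h S f" "dominated_on h S g"
  shows "dominated_on h S (\<lambda>t. pr (f t) (g t))"
proof -
  interpret bounded_bilinear pr by fact
  obtain K where K: "K \<ge> 0" "\<And>a b. norm (pr a b) \<le> norm a * norm b * K"
    using nonneg_bounded by blast
  from assms(2) obtain C M where f: "C \<ge> 0" "M \<ge> 0"
    "\<And>u v. u \<in> S \<Longrightarrow> v \<in> S \<Longrightarrow> norm (f v - f u) \<le> C * (norm (h v - h u) + \<bar>v - u\<bar>)"
    "\<And>u. u \<in> S \<Longrightarrow> norm (f u) \<le> M"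
    by (rule dominated_onE) blast
  from assms(3) obtain C' M' where g: "C' \<ge> 0" "M' \<ge> 0"
    "\<And>u v. u \<in> S \<Longrightarrow> v \<in> S \<Longrightarrow> norm (g v - g u) \<le> C' * (norm (h v - h u) + \<bar>v - u\<bar>)"
    "\<And>u. u \<in> S \<Longrightarrow> norm (g u) \<le> M'"
    by (rule dominated_onE) blast
  show ?thesis
  proof (rule dominated_onI)
    show "0 \<le> (C * M' + M * C') * K" using f g K by simp
    fix u v assume uv: "u \<in> S" "v \<in> S"
    let ?d = "norm (h v - h u) + \<bar>v - u\<bar>"
    have "pr (f v) (g v) - pr (f u) (g u) = pr (f v - f u) (g v) + pr (f u) (g v - g u)"
      by (simp add: diff_left diff_right)
    then have "norm (pr (f v) (g v) - pr (f u) (g u))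
        \<le> norm (f v - f u) * norm (g v) * K + norm (f u) * norm (g v - g u) * K"
      using norm_triangle_le[OF add_mono[OF K(2) K(2)]] by metis
    also have "\<dots> \<le> (C * ?d) * M' * K + M * (C' * ?d) * K"
      using f g K uv by (intro add_mono mult_mono mult_nonneg_nonneg) auto
    finally show "norm (pr (f v) (g v) - pr (f u) (g u)) \<le> (C * M' + M * C') * K * ?d"
      by (simp add: algebra_simps)
  next
    fix u assume u: "u \<in> S"
    show "norm (pr (f u) (g u)) \<le> M * M' * K"
      by (rule order_trans[OF K(2)])
        (use f(4)[OF u] g(4)[OF u] f(2) g(2) K in \<open>intro mult_mono mult_nonneg_nonneg, auto\<close>)
  qed
qed

lemma dominated_on_const: "dominated_on h S (\<lambda>t. c)"
  by (rule dominated_onI[of 0 S _ h "norm c"]) auto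

lemma dominated_on_add:
  assumes "dominated_on h S f" "dominated_on h S g"
  shows "dominated_on h S (\<lambda>t. f t + g t)"
proof -
  from assms(1) obtain C M where f: "C \<ge> 0" "M \<ge> 0"
    "\<And>u v. u \<in> S \<Longrightarrow> v \<in> S \<Longrightarrow> norm (f v - f u) \<le> C * (norm (h v - h u) + \<bar>v - u\<bar>)"
    "\<And>u. u \<in> S \<Longrightarrow> norm (f u) \<le> M"
    by (rule dominated_onE) blast
  from assms(2) obtain C' M' where g: "C' \<ge> 0" "M' \<ge> 0"
    "\<And>u v. u \<in> S \<Longrightarrow> v \<in> S \<Longrightarrow> norm (g v - g u) \<le> C' * (norm (h v - h u) + \<bar>v - u\<bar>)"
    "\<And>u. u \<in> S \<Longrightarrow> norm (g u) \<le> M'"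
    by (rule dominated_onE) blast
  show ?thesis
  proof (rule dominated_onI)
    show "0 \<le> C + C'" using f g by simp
    fix u v assume uv: "u \<in> S" "v \<in> S"
    have "f v + g v - (f u + g u) = (f v - f u) + (g v - g u)" by simp
    then have "norm (f v + g v - (f u + g u)) \<le> norm (f v - f u) + norm (g v - g u)"
      by (metis norm_triangle_ineq)
    then show "norm (f v + g v - (f u + g u)) \<le> (C + C') * (norm (h v - h u) + \<bar>v - u\<bar>)"
      using f(3)[OF uv] g(3)[OF uv] by (simp add: distrib_right)
  next
    fix u assume "u \<in> S"
    then show "norm (f u + g u) \<le> M + M'"
      using norm_triangle_mono[OF f(4) g(4)] by blast
  qed
qed

lemmas dominated_on_scaleR = dominated_on_bilinear[OF bounded_bilinear_scaleR]
lemmas dominated_on_mult = dominated_on_bilinear[OF bounded_bilinear_mult]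
lemmas dominated_on_inner = dominated_on_bilinear[OF bounded_bilinear_inner]

lemma dominated_on_diff:
  assumes "dominated_on h S f" "dominated_on h S g"
  shows "dominated_on h S (\<lambda>t. f t - g t)"
  using dominated_on_add[OF assms(1)
      dominated_on_scaleR[OF dominated_on_const[of h S "- 1 :: real"] assms(2)]]
  by simp

lemma dominated_on_self:
  assumes "bounded (h ` S)"
  shows "dominated_on h S h"
  using assms unfolding dominated_on_def by (auto intro!: exI[of _ 1])

text \<open>Serves \<open>B\<close> along the trajectory and the Tikhonov curve, for which only
  increments are controlled.\<close>

lemma dominated_on_lipschitz:
  assumes "dominated_on h S f" "K \<ge> 0"
    and lip: "\<And>u v. u \<in> S \<Longrightarrow> v \<in> S \<Longrightarrow> norm (g v - g u) \<le> K * norm (f v - f u)"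
  shows "dominated_on h S g"
proof (cases "S = {}")
  case True
  then show ?thesis by (auto simp: dominated_on_def)
next
  case False
  then obtain w where w: "w \<in> S" by blast
  from assms(1) obtain C M where f: "C \<ge> 0" "M \<ge> 0"
    "\<And>u v. u \<in> S \<Longrightarrow> v \<in> S \<Longrightarrow> norm (f v - f u) \<le> C * (norm (h v - h u) + \<bar>v - u\<bar>)"
    "\<And>u. u \<in> S \<Longrightarrow> norm (f u) \<le> M"
    by (rule dominated_onE) blast
  show ?thesis
  proof (rule dominated_onI)
    show "0 \<le> K * C" using f assms(2) by simp
    fix u v assume uv: "u \<in> S" "v \<in> S"
    show "norm (g v - g u) \<le> K * C * (norm (h v - h u) + \<bar>v - u\<bar>)"
      using order_trans[OF lip[OF uv] mult_left_mono[OF f(3)[OF uv] assms(2)]]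
      by (simp add: mult.assoc)
  next
    fix u assume u: "u \<in> S"
    have "norm (f u - f w) \<le> M + M"
      using norm_triangle_ineq4[of "f u" "f w"] f(4)[OF u] f(4)[OF w] by linarith
    then have "norm (g u - g w) \<le> K * (M + M)"
      using order_trans[OF lip[OF w u]] assms(2) by (simp add: mult_left_mono)
    then show "norm (g u) \<le> K * (M + M) + norm (g w)"
      using norm_triangle_sub[of "g u" "g w"] by linarith
  qed
qed

text \<open>By the mean value inequality, the summand \<open>\<bar>v - u\<bar>\<close> in
  \<open>dominated_on\<close> admits every such function, whatever \<open>h\<close> is.\<close>

lemma dominated_on_C1:
  fixes f :: "real \<Rightarrow> 'a::real_normed_vector"
  assumes der: "\<And>t. t \<in> {a..b} \<Longrightarrow> (f has_vector_derivative f' t) (at t within {a..b})"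
    and cont: "continuous_on {a..b} f'"
  shows "dominated_on h {a..b} f"
proof -
  have "bounded (f' ` {a..b})"
    by (intro compact_imp_bounded compact_continuous_image cont compact_Icc)
  then obtain C where C: "C > 0" "\<And>t. t \<in> {a..b} \<Longrightarrow> norm (f' t) \<le> C"
    unfolding bounded_pos by auto
  have "bounded (f ` {a..b})"
    by (intro compact_imp_bounded compact_continuous_image compact_Icc
        continuous_on_vector_derivative[OF der])
  then obtain M where M: "\<And>t. t \<in> {a..b} \<Longrightarrow> norm (f t) \<le> M"
    unfolding bounded_pos by blast
  show ?thesis
  proof (rule dominated_onI[OF _ _ M])
    show "0 \<le> C" using C by simp
    fix u v assume uv: "u \<in> {a..b}" "v \<in> {a..b}"
    have "norm (f v - f u) \<le> C * norm (v - u)"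
    proof (rule differentiable_bound[of "{a..b}" f "\<lambda>t s. s *\<^sub>R f' t"])
      show "(f has_derivative (\<lambda>s. s *\<^sub>R f' t)) (at t within {a..b})" if "t \<in> {a..b}" for t
        using der[OF that] by (simp add: has_vector_derivative_def)
      show "onorm (\<lambda>s. s *\<^sub>R f' t) \<le> C" if "t \<in> {a..b}" for t
        using C(2)[OF that] by (intro onorm_le) (simp add: mult.commute[of _ "norm (f' t)"] mult_right_mono)
    qed (use uv in auto)
    also have "\<dots> \<le> C * (norm (h v - h u) + \<bar>v - u\<bar>)"
      using C by (intro mult_left_mono) auto
    finally show "norm (f v - f u) \<le> C * (norm (h v - h u) + \<bar>v - u\<bar>)" .
  qed
qed

section \<open>Absolute continuity and monotonicity from difference quotients\<close>

lemma abs_continuous_on_interval_continuous_on: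
  assumes "abs_continuous_on_interval a b f"
  shows "continuous_on {a..b} f"
  unfolding continuous_on_iff
proof (intro ballI allI impI)
  fix t e :: real assume t: "t \<in> {a..b}" and e: "e > 0"
  from assms[unfolded abs_continuous_on_interval_def, rule_format, OF e]
  obtain d where d: "d > 0" and D: "\<And>D. finite D \<and> (\<forall>(u, v) \<in> D. a \<le> u \<and> u < v \<and> v \<le> b) \<and>
        disjoint_family_on (\<lambda>(u, v). {u<..<v}) D \<and>
        (\<Sum>(u, v)\<in>D. v - u) < d
        \<Longrightarrow> (\<Sum>(u, v)\<in>D. norm (f v - f u)) < e" by blast
  have "norm (f v - f u) < e" if "u \<in> {a..b}" "v \<in> {a..b}" "u < v" "v - u < d" for u v
    using D[of "{(u, v)}"] that by (simp add: disjoint_family_on_def)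
  then have "dist (f s) (f t) < e" if "s \<in> {a..b}" "dist s t < d" for s
    using that t e unfolding dist_real_def
    by (cases s t rule: linorder_cases) (force simp: dist_norm norm_minus_commute)+
  then show "\<exists>d>0. \<forall>s\<in>{a..b}. dist s t < d \<longrightarrow> dist (f s) (f t) < e" using d by blast
qed

lemma abs_continuous_on_interval_subset:
  assumes "abs_continuous_on_interval a b f" "a \<le> a'" "b' \<le> b"
  shows "abs_continuous_on_interval a' b' f"
  unfolding abs_continuous_on_interval_def
proof (intro allI impI)
  fix e :: real assume "e > 0"
  from assms(1)[unfolded abs_continuous_on_interval_def, rule_format, OF this]
  obtain d where "d > 0" and d: "\<And>D. finite D \<and> (\<forall>(u, v) \<in> D. a \<le> u \<and> u < v \<and> v \<le> b) \<and>
        disjoint_family_on (\<lambda>(u, v). {u<..<v}) D \<and> (\<Sum>(u, v)\<in>D. v - u) < d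
        \<Longrightarrow> (\<Sum>(u, v)\<in>D. norm (f v - f u)) < e" by blast
  show "\<exists>d>0. \<forall>D. finite D \<and> (\<forall>(u, v) \<in> D. a' \<le> u \<and> u < v \<and> v \<le> b') \<and>
        disjoint_family_on (\<lambda>(u, v). {u<..<v}) D \<and> (\<Sum>(u, v)\<in>D. v - u) < d
        \<longrightarrow> (\<Sum>(u, v)\<in>D. norm (f v - f u)) < e"
  proof (intro exI[of _ d] conjI allI impI \<open>d > 0\<close>)
    fix D :: "(real \<times> real) set"
    assume "finite D \<and> (\<forall>(u, v) \<in> D. a' \<le> u \<and> u < v \<and> v \<le> b') \<and>
        disjoint_family_on (\<lambda>(u, v). {u<..<v}) D \<and> (\<Sum>(u, v)\<in>D. v - u) < d"
    then show "(\<Sum>(u, v)\<in>D. norm (f v - f u)) < e"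
      using assms(2,3) by (intro d) fastforce
  qed
qed

text \<open>
  By Cousin's lemma: the intervals of a fine division with tags in \<open>N\<close> lie in an open set of small
  measure and are controlled by absolute continuity, the others by the difference quotients.
\<close>

lemma abs_continuous_comparison:
  fixes g :: "real \<Rightarrow> real" and h :: "real \<Rightarrow> 'a::real_normed_vector"
  assumes ab: "a \<le> b" and h: "abs_continuous_on_interval a b h"
    and dom: "dominated_on h {a..b} g" and N: "negligible N"
    and quot: "\<And>t e. t \<in> {a..b} \<Longrightarrow> t \<notin> N \<Longrightarrow> e > 0 \<Longrightarrow>
      \<forall>\<^sub>F s in at t within {a..b}. (g s - g t) / (s - t) \<le> e"
  shows "g b \<le> g a"
proof -
  from dom obtain C where C: "C \<ge> 0"
    "\<And>u v. u \<in> {a..b} \<Longrightarrow> v \<in> {a..b} \<Longrightarrow> norm (g v - g u) \<le> C * (norm (h v - h u) + \<bar>v - u\<bar>)"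
    by (rule dominated_onE) blast
  \<comment> \<open>The share \<open>e * (b - a)\<close> comes from the intervals with tags outside
    \<open>N\<close>. The others contribute \<open>C * e\<close> through the variation of
    \<open>h\<close> and \<open>C * e\<close> through their total length.\<close>
  have main: "g b - g a \<le> e * (b - a + 2 * C)" if e: "e > 0" for e
  proof -
    from h[unfolded abs_continuous_on_interval_def, rule_format, OF e]
    obtain d where d: "d > 0" and small: "\<And>D. finite D \<Longrightarrow>
        (\<forall>(u, v) \<in> D. a \<le> u \<and> u < v \<and> v \<le> b) \<Longrightarrow>
        disjoint_family_on (\<lambda>(u, v). {u<..<v}) D \<Longrightarrow> (\<Sum>(u, v)\<in>D. v - u) < d \<Longrightarrow>
        (\<Sum>(u, v)\<in>D. norm (h v - h u)) < e" by blast
    \<comment> \<open>The bound \<open>d\<close> makes absolute continuity applicable; the bound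
      \<open>e\<close> makes the total length itself small.\<close>
    obtain T where T: "open T" "N \<subseteq> T" "T \<in> lmeasurable" "measure lebesgue T < min d e"
    proof -
      obtain T where T: "open T" "N \<subseteq> T" "T - N \<in> lmeasurable"
        "emeasure lebesgue (T - N) < ennreal (min d e)"
        using sets_lebesgue_outer_open[of N "min d e"] N d e negligible_imp_sets by auto
      have NT: "T = (T - N) \<union> N" using T by blast
      have NL: "N \<in> lmeasurable" "measure lebesgue N = 0"
        using N by (auto simp: negligible_iff_measure)
      have "T \<in> lmeasurable" using NT T(3) NL by (metis fmeasurable.Un)
      moreover have "measure lebesgue T \<le> measure lebesgue (T - N) + measure lebesgue N"
        using measure_Un_le[of "T - N" lebesgue N] NT T(3) NL by (metis fmeasurableD)
      moreover have "measure lebesgue (T - N) < min d e"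
        using T(3,4) d e by (simp add: emeasure_eq_measure2 ennreal_less_iff)
      ultimately show thesis using that[of T] T NL by simp
    qed
    have "\<exists>r>0. \<forall>s\<in>{a..b}. s \<noteq> t \<and> dist s t < r \<longrightarrow> (g s - g t) / (s - t) \<le> e"
      if "t \<in> {a..b}" "t \<notin> N" for t
      using quot[OF that e] unfolding eventually_at by auto
    then obtain r where r: "\<And>t. t \<in> {a..b} \<Longrightarrow> t \<notin> N \<Longrightarrow> r t > 0"
      "\<And>t s. t \<in> {a..b} \<Longrightarrow> t \<notin> N \<Longrightarrow> s \<in> {a..b} \<Longrightarrow> s \<noteq> t \<Longrightarrow> dist s t < r t \<Longrightarrow>
        (g s - g t) / (s - t) \<le> e"
      by metis
    \<comment> \<open>\<open>UNIV\<close> is a default for points outside the interval, which never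
      occur as tags.\<close>
    define G where "G t = (if t \<in> N then T else if t \<in> {a..b} then ball t (r t) else UNIV)" for t
    have "gauge G" unfolding gauge_def G_def using T(1,2) r(1) by auto
    then obtain p where p: "p tagged_division_of {a..b}" "G fine p"
      by (rule fine_division_exists_real)
    have fin: "finite p" using p(1) by (rule tagged_division_of_finite)
    have K: "\<exists>u v. K = {u..v} \<and> u \<le> v \<and> a \<le> u \<and> v \<le> b \<and> t \<in> {u..v} \<and> {u..v} \<subseteq> G t"
      if tK: "(t, K) \<in> p" for t K
    proof -
      have "t \<in> K" "K \<subseteq> {a..b}" "\<exists>u v. K = cbox u v"
        using tagged_division_ofD(2-4)[OF p(1) tK] by auto
      moreover have "K \<subseteq> G t" using fineD[OF p(2) tK] .
      ultimately show ?thesis by fastforce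
    qed
    \<comment> \<open>Degenerate intervals contribute nothing and are left out: nonempty disjoint
      interiors are what makes \<open>\<phi>\<close> injective.\<close>
    define bad where "bad = {(t, K) \<in> p. t \<in> N \<and> Inf K < Sup K}"
    define \<phi> where "\<phi> = (\<lambda>(t::real, K::real set). (Inf K, Sup K))"
    define J where "J = (\<lambda>(u::real, v::real). {u<..<v})"
    have disj: "J (\<phi> x) \<inter> J (\<phi> y) = {}" if xy: "x \<in> bad" "y \<in> bad" "x \<noteq> y" for x y
    proof -
      obtain t K where x: "x = (t, K)" by fastforce
      obtain t' K' where y: "y = (t', K')" by fastforce
      have "(t, K) \<in> p" "(t', K') \<in> p" using xy by (auto simp: bad_def x y)
      moreover obtain u v where "K = {u..v}" "u \<le> v" using K calculation(1) by blast
      moreover obtain u' v' where "K' = {u'..v'}" "u' \<le> v'" using K calculation(2) by blast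
      moreover have "interior K \<inter> interior K' = {}"
        using tagged_division_ofD(5)[OF p(1)] calculation(1,2) xy(3) x y by blast
      ultimately show ?thesis by (simp add: J_def \<phi>_def x y interior_atLeastAtMost_real)
    qed
    have nonempty: "J (\<phi> x) \<noteq> {}" if "x \<in> bad" for x
      using that by (auto simp: bad_def J_def \<phi>_def dest: dense)
    have inj: "inj_on \<phi> bad"
      by (rule inj_onI) (metis disj nonempty Int_absorb)
    have fin_bad: "finite bad" using fin by (rule rev_finite_subset) (auto simp: bad_def)
    define D where "D = \<phi> ` bad"
    have D_range: "\<forall>(u, v) \<in> D. a \<le> u \<and> u < v \<and> v \<le> b"
      using K by (fastforce simp: D_def bad_def \<phi>_def)
    have D_disj: "disjoint_family_on J D"
      unfolding disjoint_family_on_def D_def using disj by blast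
    have D_T: "J x \<subseteq> T" if xD: "x \<in> D" for x
    proof -
      obtain t K' where tK: "(t, K') \<in> p" "t \<in> N" "x = (Inf K', Sup K')"
        using xD by (auto simp: D_def bad_def \<phi>_def)
      obtain u v where "K' = {u..v}" "u \<le> v" "{u..v} \<subseteq> G t" using K[OF tK(1)] by blast
      then show ?thesis using tK by (auto simp: J_def G_def)
    qed
    have J_lmeasurable: "J x \<in> lmeasurable" for x
      by (intro bounded_set_imp_lmeasurable) (auto simp: J_def split_beta)
    have len: "(\<Sum>(u, v)\<in>D. v - u) < min d e"
    proof -
      have "(\<Sum>(u, v)\<in>D. v - u) = (\<Sum>x\<in>D. measure lebesgue (J x))"
        using D_range by (intro sum.cong) (auto simp: J_def)
      also have "\<dots> = measure lebesgue (\<Union>x\<in>D. J x)"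
        using fin_bad D_disj fmeasurableD2[OF J_lmeasurable] fmeasurableD[OF J_lmeasurable]
        by (intro measure_finite_Union[symmetric]) (auto simp: D_def)
      also have "\<dots> \<le> measure lebesgue T"
      proof (rule measure_mono_fmeasurable)
        show "(\<Union>x\<in>D. J x) \<subseteq> T" using D_T by blast
        show "(\<Union>x\<in>D. J x) \<in> sets lebesgue"
          by (intro sets.finite_UN fmeasurableD J_lmeasurable) (simp add: D_def fin_bad)
      qed (rule T(3))
      finally show ?thesis using T(4) by linarith
    qed
    have var: "(\<Sum>(u, v)\<in>D. norm (h v - h u)) < e"
      by (rule small) (use fin_bad D_range D_disj len in \<open>auto simp: D_def J_def\<close>)
    define W where "W = (\<lambda>(u, v). C * (norm (h v - h u) + \<bar>v - u\<bar>))"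
    have step: "g (Sup K') - g (Inf K') \<le> e * (Sup K' - Inf K') + (if (t, K') \<in> bad then W (\<phi> (t, K')) else 0)"
      if tK: "(t, K') \<in> p" for t K'
    proof -
      obtain u v where uv: "K' = {u..v}" "u \<le> v" "a \<le> u" "v \<le> b" "t \<in> {u..v}" "{u..v} \<subseteq> G t"
        using K[OF tK] by blast
      consider "u = v" | "u < v" "t \<in> N" | "t \<notin> N" using uv(2) by linarith
      then show ?thesis
      proof cases
        case 1
        then show ?thesis using uv by (simp add: bad_def)
      next
        case 2
        then have "(t, K') \<in> bad" using tK uv by (simp add: bad_def)
        moreover have "g v - g u \<le> W (u, v)" using C(2)[of u v] uv by (simp add: W_def)
        moreover have "0 \<le> e * (v - u)" using e uv by simp
        ultimately show ?thesis using uv by (simp add: \<phi>_def)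
      next
        case 3
        then have t: "t \<in> {a..b}" "{u..v} \<subseteq> ball t (r t)" using uv by (auto simp: G_def split: if_splits)
        \<comment> \<open>The tag may be interior, so the interval is split at \<open>t\<close> and
          the quotient bound is used on each side.\<close>
        have "g v - g t \<le> e * (v - t)"
        proof (cases "v = t")
          case False
          have "dist v t < r t" using t(2) uv(2) by (auto simp: dist_commute subset_iff)
          from r(2)[OF t(1) 3 _ False this] show ?thesis
            using uv False by (simp add: field_simps)
        qed simp
        moreover have "g t - g u \<le> e * (t - u)"
        proof (cases "u = t")
          case False
          have "dist u t < r t" using t(2) uv(2) by (auto simp: dist_commute subset_iff)
          from r(2)[OF t(1) 3 _ False this] have "(g t - g u) / (t - u) \<le> e"
            using uv by (simp add: minus_divide_divide[of "g t - g u" "t - u", symmetric])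
          then show ?thesis
            using uv False by (simp add: field_simps)
        qed simp
        moreover have "(t, K') \<notin> bad" using 3 by (simp add: bad_def)
        ultimately show ?thesis using uv by (simp add: algebra_simps)
      qed
    qed
    have "g b - g a = (\<Sum>(t, K')\<in>p. g (Sup K') - g (Inf K'))"
      by (rule additive_tagged_division_1[OF ab p(1), symmetric])
    also have "\<dots> \<le> (\<Sum>(t, K')\<in>p. e * (Sup K' - Inf K') + (if (t, K') \<in> bad then W (\<phi> (t, K')) else 0))"
      using step by (intro sum_mono) auto
    also have "\<dots> = e * (\<Sum>(t, K')\<in>p. Sup K' - Inf K') + (\<Sum>x\<in>p. if x \<in> bad then W (\<phi> x) else 0)"
      by (simp add: sum.distrib sum_distrib_left split_beta cong: if_cong)
    also have "(\<Sum>(t, K')\<in>p. Sup K' - Inf K') = b - a"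
      using additive_tagged_division_1[OF ab p(1), of "\<lambda>x. x"] .
    also have "(\<Sum>x\<in>p. if x \<in> bad then W (\<phi> x) else 0) = (\<Sum>x\<in>bad. W (\<phi> x))"
      using fin by (subst sum.inter_restrict[symmetric]) (auto simp: bad_def intro!: sum.cong)
    also have "\<dots> = (\<Sum>x\<in>D. W x)" unfolding D_def by (simp add: sum.reindex[OF inj])
    also have "\<dots> = C * ((\<Sum>(u, v)\<in>D. norm (h v - h u)) + (\<Sum>(u, v)\<in>D. v - u))"
      unfolding W_def sum_distrib_left sum.distrib[symmetric]
      using D_range by (intro sum.cong) auto
    also have "\<dots> \<le> C * (e + e)"
      using C(1) var len by (intro mult_left_mono) auto
    finally show ?thesis by (simp add: algebra_simps)
  qed
  have "((\<lambda>e. e * (b - a + 2 * C)) \<longlongrightarrow> 0 * (b - a + 2 * C)) (at_right (0::real))"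
    by (intro tendsto_intros)
  then have "g b - g a \<le> 0 * (b - a + 2 * C)"
    by (rule tendsto_lowerbound) (use main in \<open>auto simp: eventually_at_right_field intro: exI[of _ 1]\<close>)
  then show ?thesis by simp
qed

section \<open>The Lyapunov function\<close>

text \<open>
  The term \<open>U \<bullet> b\<close> carries a factor \<open>1 / q\<^sup>2\<close>. It is absorbed by the surplus \<open>\<beta> \<parallel>b\<parallel>\<^sup>2\<close> of cocoercivity
  over monotonicity, at the price of the coefficient \<open>r\<^sup>2\<close>.
\<close>

lemma lyapunov_derivative_le:
  fixes e U b v :: "'a::real_inner"
  assumes pos: "q > 0" "\<beta> > 0" "\<gamma> > 0" "d > 0"
    and coco: "\<beta> * (b \<bullet> b) \<le> e \<bullet> b"
    and v: "v = q *\<^sub>R (U - d *\<^sub>R e - (1 / (\<gamma> * q\<^sup>2)) *\<^sub>R (b + q\<^sup>2 *\<^sub>R e))"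
  shows "\<gamma> * d * (e \<bullet> v) + U \<bullet> (- ((\<gamma> - 2 * (r * q)) * q) *\<^sub>R (U - d *\<^sub>R e) - (r * q) *\<^sub>R v)
    \<le> q * (- (\<gamma> * d\<^sup>2 + d) * (e \<bullet> e) + 2 * \<gamma> * d * (e \<bullet> U) - \<gamma> * (U \<bullet> U)
        + r * q * (1 / \<gamma> - d) * (e \<bullet> U) + (r * q + r\<^sup>2 / (4 * \<gamma>\<^sup>2 * d * \<beta>)) * (U \<bullet> U))"
proof -
  \<comment> \<open>Chosen so that the cross term of \<open>d * \<beta>\<close> times the square of
    \<open>b - c *\<^sub>R U\<close> is \<open>- (r * q / \<gamma>) * (U \<bullet> b)\<close>;
    division by \<open>q\<close> then produces the term to be absorbed.\<close>
  define c where "c = r * q / (2 * \<gamma> * d * \<beta>)"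
  have "0 \<le> (b - c *\<^sub>R U) \<bullet> (b - c *\<^sub>R U)" by simp
  then have "0 \<le> (b \<bullet> b) - 2 * c * (U \<bullet> b) + c\<^sup>2 * (U \<bullet> U)"
    by (simp add: inner_diff_left inner_diff_right inner_commute power2_eq_square)
  then have "0 \<le> d * \<beta> * ((b \<bullet> b) - 2 * c * (U \<bullet> b) + c\<^sup>2 * (U \<bullet> U))"
    using pos by simp
  also have "\<dots> = d * (\<beta> * (b \<bullet> b)) - r * q / \<gamma> * (U \<bullet> b) + (r * q)\<^sup>2 / (4 * \<gamma>\<^sup>2 * d * \<beta>) * (U \<bullet> U)"
    using pos by (simp add: c_def field_simps power2_eq_square)
  also have "\<dots> \<le> d * (e \<bullet> b) - r * q / \<gamma> * (U \<bullet> b) + (r * q)\<^sup>2 / (4 * \<gamma>\<^sup>2 * d * \<beta>) * (U \<bullet> U)"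
    using coco pos by simp
  finally have "0 \<le> (d * (e \<bullet> b) - r * q / \<gamma> * (U \<bullet> b) + (r * q)\<^sup>2 / (4 * \<gamma>\<^sup>2 * d * \<beta>) * (U \<bullet> U)) / q"
    using pos by simp
  also have "\<dots> = q * (r\<^sup>2 / (4 * \<gamma>\<^sup>2 * d * \<beta>)) * (U \<bullet> U) + d * (e \<bullet> b) / q - r / \<gamma> * (U \<bullet> b)"
    using pos by (simp add: field_simps power2_eq_square)
  finally have young: "r / \<gamma> * (U \<bullet> b) - d * (e \<bullet> b) / q \<le> q * (r\<^sup>2 / (4 * \<gamma>\<^sup>2 * d * \<beta>)) * (U \<bullet> U)"
    by simp
  have ev: "e \<bullet> v = q * ((e \<bullet> U) - d * (e \<bullet> e) - (e \<bullet> e) / \<gamma>) - (e \<bullet> b) / (\<gamma> * q)"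
    using pos unfolding v by (simp add: inner_diff_right inner_add_right field_simps power2_eq_square)
  have Uv: "U \<bullet> v = q * ((U \<bullet> U) - d * (e \<bullet> U) - (e \<bullet> U) / \<gamma>) - (U \<bullet> b) / (\<gamma> * q)"
    using pos unfolding v
    by (simp add: inner_diff_right inner_add_right inner_commute field_simps power2_eq_square)
  have "\<gamma> * d * (e \<bullet> v) + U \<bullet> (- ((\<gamma> - 2 * (r * q)) * q) *\<^sub>R (U - d *\<^sub>R e) - (r * q) *\<^sub>R v)
    = \<gamma> * d * (e \<bullet> v) - (\<gamma> - 2 * (r * q)) * q * ((U \<bullet> U) - d * (e \<bullet> U)) - r * q * (U \<bullet> v)"
    by (simp add: inner_diff_right inner_commute algebra_simps)
  also have "\<dots> = q * (- (\<gamma> * d\<^sup>2 + d) * (e \<bullet> e) + 2 * \<gamma> * d * (e \<bullet> U) - \<gamma> * (U \<bullet> U)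
        + r * q * (1 / \<gamma> - d) * (e \<bullet> U) + r * q * (U \<bullet> U))
        + (r / \<gamma> * (U \<bullet> b) - d * (e \<bullet> b) / q)"
    unfolding ev Uv using pos by (simp add: field_simps power2_eq_square)
  also have "\<dots> \<le> q * (- (\<gamma> * d\<^sup>2 + d) * (e \<bullet> e) + 2 * \<gamma> * d * (e \<bullet> U) - \<gamma> * (U \<bullet> U)
        + r * q * (1 / \<gamma> - d) * (e \<bullet> U) + r * q * (U \<bullet> U))
        + q * (r\<^sup>2 / (4 * \<gamma>\<^sup>2 * d * \<beta>)) * (U \<bullet> U)"
    using young by simp
  finally show ?thesis by (simp add: algebra_simps)
qed

text \<open>The form is \<open>- \<gamma> * P - d * (e \<bullet> e)\<close> with \<open>P\<close>
  the square of \<open>U - d *\<^sub>R e\<close>. The two conditions on \<open>m\<close> arise from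
  recovering \<open>U\<close> through
  \<open>U \<bullet> U \<le> 2 * P + 2 * d\<^sup>2 * (e \<bullet> e)\<close>.\<close>

lemma quadratic_form_coercive:
  fixes e U :: "'a::real_inner"
  assumes "2 * m \<le> \<gamma>" "m * (2 * d\<^sup>2 + 1) \<le> d" "m > 0"
  shows "- (\<gamma> * d\<^sup>2 + d) * (e \<bullet> e) + 2 * \<gamma> * d * (e \<bullet> U) - \<gamma> * (U \<bullet> U)
    \<le> - m * ((e \<bullet> e) + (U \<bullet> U))"
proof -
  define P where "P = (U - d *\<^sub>R e) \<bullet> (U - d *\<^sub>R e)"
  have P: "P = (U \<bullet> U) - 2 * d * (e \<bullet> U) + d\<^sup>2 * (e \<bullet> e)"
    by (simp add: P_def inner_diff_left inner_diff_right inner_commute power2_eq_square)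
  have "0 \<le> (U - (2 * d) *\<^sub>R e) \<bullet> (U - (2 * d) *\<^sub>R e)" by simp
  then have "U \<bullet> U \<le> 2 * P + 2 * d\<^sup>2 * (e \<bullet> e)"
    unfolding P by (simp add: inner_diff_left inner_diff_right inner_commute power2_eq_square algebra_simps)
  then have "m * (U \<bullet> U) \<le> m * (2 * P + 2 * d\<^sup>2 * (e \<bullet> e))"
    using assms(3) by simp
  then have "m * ((e \<bullet> e) + (U \<bullet> U)) \<le> (2 * m) * P + m * (2 * d\<^sup>2 + 1) * (e \<bullet> e)"
    by (simp add: algebra_simps)
  also have "\<dots> \<le> \<gamma> * P + d * (e \<bullet> e)"
    using assms by (intro add_mono mult_right_mono) (auto simp: P_def)
  finally show ?thesis unfolding P by (simp add: algebra_simps)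
qed

text \<open>With \<open>S = e \<bullet> e + U \<bullet> U\<close>, the leading form supplies
  \<open>- m * S\<close>. Half of it pays for the terms in \<open>r\<close>, a quarter for the
  anchor drift by Young's inequality with remainder at most \<open>c * k\<close>, and
  \<open>c\<close> is chosen so that the last quarter dominates \<open>c\<close> times the Lyapunov
  function.\<close>

lemma lyapunov_decay:
  fixes e U b v :: "'a::real_inner"
  assumes pos: "q > 0" "\<beta> > 0" "\<gamma> > 0" "d > 0" "r \<ge> 0" "Z \<ge> 0"
    and coco: "\<beta> * (b \<bullet> b) \<le> e \<bullet> b"
    and v: "v = q *\<^sub>R (U - d *\<^sub>R e - (1 / (\<gamma> * q\<^sup>2)) *\<^sub>R (b + q\<^sup>2 *\<^sub>R e))"
    and m: "2 * m \<le> \<gamma>" "m * (2 * d\<^sup>2 + 1) \<le> d" "m > 0"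
    and small: "r * q * (1 / \<gamma> + d) + r * q + r\<^sup>2 / (4 * \<gamma>\<^sup>2 * d * \<beta>) \<le> m / 2"
    and c: "c = m / (2 * (\<gamma> * d + 1))"
    and k: "(r * q)\<^sup>2 * ((2 * Z * \<gamma> * d)\<^sup>2 + (2 * Z * d)\<^sup>2) / m \<le> c * k"
  shows "\<gamma> * d * (e \<bullet> v) + U \<bullet> (- ((\<gamma> - 2 * (r * q)) * q) *\<^sub>R (U - d *\<^sub>R e) - (r * q) *\<^sub>R v)
      + (\<gamma> * d * norm e + d * norm U) * (2 * (r * q) * q * Z)
    \<le> - c * q * (\<gamma> * d / 2 * (norm e)\<^sup>2 + 1 / 2 * (norm U)\<^sup>2 - k)"
proof -
  define S where "S = (e \<bullet> e) + (U \<bullet> U)"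
  define \<kappa> where "\<kappa> = r * q"
  have \<kappa>: "\<kappa> \<ge> 0" using pos by (simp add: \<kappa>_def)
  have eU: "\<bar>e \<bullet> U\<bar> \<le> S"
  proof -
    have "0 \<le> (e - U) \<bullet> (e - U)" "0 \<le> (e + U) \<bullet> (e + U)" "0 \<le> e \<bullet> e" "0 \<le> U \<bullet> U" by simp_all
    then show ?thesis
      unfolding S_def inner_diff_left inner_diff_right inner_add_left inner_add_right
        inner_commute[of U e] by linarith
  qed
  have "\<kappa> * (1 / \<gamma> - d) * (e \<bullet> U) \<le> \<bar>\<kappa> * (1 / \<gamma> - d) * (e \<bullet> U)\<bar>" by simp
  also have "\<dots> = \<kappa> * \<bar>1 / \<gamma> - d\<bar> * \<bar>e \<bullet> U\<bar>" using \<kappa> by (simp add: abs_mult)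
  also have "\<dots> \<le> \<kappa> * (1 / \<gamma> + d) * S"
    using \<kappa> pos eU abs_triangle_ineq4[of "1 / \<gamma>" d] by (intro mult_mono) auto
  finally have 1: "\<kappa> * (1 / \<gamma> - d) * (e \<bullet> U) \<le> \<kappa> * (1 / \<gamma> + d) * S" .
  have 2: "(\<kappa> + r\<^sup>2 / (4 * \<gamma>\<^sup>2 * d * \<beta>)) * (U \<bullet> U) \<le> (\<kappa> + r\<^sup>2 / (4 * \<gamma>\<^sup>2 * d * \<beta>)) * S"
    using \<kappa> pos by (intro mult_left_mono) (auto simp: S_def)
  have "(\<kappa> * (1 / \<gamma> + d) + \<kappa> + r\<^sup>2 / (4 * \<gamma>\<^sup>2 * d * \<beta>)) * S \<le> m / 2 * S"
    using small unfolding \<kappa>_def[symmetric] by (intro mult_right_mono) (auto simp: S_def)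
  then have 3: "\<kappa> * (1 / \<gamma> - d) * (e \<bullet> U) + (\<kappa> + r\<^sup>2 / (4 * \<gamma>\<^sup>2 * d * \<beta>)) * (U \<bullet> U) \<le> m / 2 * S"
    using 1 2 by (simp add: algebra_simps)
  have young: "a * n \<le> m / 4 * n\<^sup>2 + a\<^sup>2 / m" for a n :: real
  proof -
    have "0 \<le> (m / 2 * n - a)\<^sup>2 / m" using m by simp
    then show ?thesis using m by (simp add: field_simps power2_eq_square)
  qed
  have "(\<gamma> * d * norm e + d * norm U) * (2 * \<kappa> * Z)
    = (\<kappa> * (2 * Z * \<gamma> * d)) * norm e + (\<kappa> * (2 * Z * d)) * norm U"
    by (simp add: algebra_simps)
  also have "\<dots> \<le> (m / 4 * (norm e)\<^sup>2 + (\<kappa> * (2 * Z * \<gamma> * d))\<^sup>2 / m)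
      + (m / 4 * (norm U)\<^sup>2 + (\<kappa> * (2 * Z * d))\<^sup>2 / m)"
    by (intro add_mono young)
  also have "\<dots> = m / 4 * S + \<kappa>\<^sup>2 * ((2 * Z * \<gamma> * d)\<^sup>2 + (2 * Z * d)\<^sup>2) / m"
    unfolding S_def power2_norm_eq_inner power_mult_distrib
    by (simp add: algebra_simps add_divide_distrib)
  also have "\<dots> \<le> m / 4 * S + c * k" using k by (simp add: \<kappa>_def)
  finally have 4: "(\<gamma> * d * norm e + d * norm U) * (2 * \<kappa> * Z) \<le> m / 4 * S + c * k" .
  have \<gamma>d: "\<gamma> * d > 0" using pos by simp
  have c_pos: "c > 0" using m \<gamma>d unfolding c by (intro divide_pos_pos) auto
  have "c * (\<gamma> * d / 2 * (norm e)\<^sup>2 + 1 / 2 * (norm U)\<^sup>2) \<le> c * ((\<gamma> * d + 1) / 2 * S)"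
  proof (intro mult_left_mono)
    have "0 \<le> \<gamma> * d * (U \<bullet> U)" "0 \<le> e \<bullet> e" using pos by auto
    then show "\<gamma> * d / 2 * (norm e)\<^sup>2 + 1 / 2 * (norm U)\<^sup>2 \<le> (\<gamma> * d + 1) / 2 * S"
      unfolding S_def power2_norm_eq_inner by (simp add: algebra_simps add_divide_distrib)
  qed (use c_pos in simp)
  also have "\<dots> = m / 4 * S"
  proof -
    have "\<gamma> * d + 1 \<noteq> 0" using \<gamma>d by linarith
    then show ?thesis by (simp add: c field_simps)
  qed
  finally have 5: "c * (\<gamma> * d / 2 * (norm e)\<^sup>2 + 1 / 2 * (norm U)\<^sup>2) \<le> m / 4 * S" .
  have "(- (\<gamma> * d\<^sup>2 + d) * (e \<bullet> e) + 2 * \<gamma> * d * (e \<bullet> U) - \<gamma> * (U \<bullet> U)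
        + \<kappa> * (1 / \<gamma> - d) * (e \<bullet> U) + (\<kappa> + r\<^sup>2 / (4 * \<gamma>\<^sup>2 * d * \<beta>)) * (U \<bullet> U))
        + (\<gamma> * d * norm e + d * norm U) * (2 * \<kappa> * Z)
      \<le> - (c * (\<gamma> * d / 2 * (norm e)\<^sup>2 + 1 / 2 * (norm U)\<^sup>2)) + c * k"
    using quadratic_form_coercive[OF m, of e U] 3 4 5 unfolding S_def[symmetric] by linarith
  from mult_left_mono[OF this less_imp_le[OF pos(1)]]
  have "q * (- (\<gamma> * d\<^sup>2 + d) * (e \<bullet> e) + 2 * \<gamma> * d * (e \<bullet> U) - \<gamma> * (U \<bullet> U)
        + \<kappa> * (1 / \<gamma> - d) * (e \<bullet> U) + (\<kappa> + r\<^sup>2 / (4 * \<gamma>\<^sup>2 * d * \<beta>)) * (U \<bullet> U))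
        + (\<gamma> * d * norm e + d * norm U) * (2 * \<kappa> * q * Z)
      \<le> - c * q * (\<gamma> * d / 2 * (norm e)\<^sup>2 + 1 / 2 * (norm U)\<^sup>2 - k)"
    by (simp add: algebra_simps)
  then show ?thesis
    using lyapunov_derivative_le[OF pos(1-4) coco v, of r] unfolding \<kappa>_def by linarith
qed

text \<open>To be instantiated with the Yosida regularization for \<open>B\<close>,
  \<open>\<rho> + \<eta>\<close> for \<open>\<beta>\<close> and \<open>\<delta> - \<gamma>\<close>
  for \<open>d\<close>. The point \<open>z\<close> is an arbitrary zero of \<open>B\<close>, whose
  norm bounds the Tikhonov curve and its speed in \<open>ln \<epsilon>\<close>.\<close>

locale inertial_tikhonov_flow =
  fixes B :: "'a::{real_inner, complete_space} \<Rightarrow> 'a"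
    and \<beta> \<gamma> d t\<^sub>0 :: real and \<epsilon> \<epsilon>' :: "real \<Rightarrow> real"
    and x v :: "real \<Rightarrow> 'a" and N :: "real set" and z :: 'a
  assumes coco: "cocoercive \<beta> B" and pos: "\<beta> > 0" "\<gamma> > 0" "d > 0"
    and \<epsilon>_pos: "\<And>t. t \<ge> t\<^sub>0 \<Longrightarrow> \<epsilon> t > 0"
    and \<epsilon>_antimono: "antimono_on {t\<^sub>0..} \<epsilon>"
    and \<epsilon>_deriv: "\<And>t. t \<ge> t\<^sub>0 \<Longrightarrow> (\<epsilon> has_real_derivative \<epsilon>' t) (at t within {t\<^sub>0..})"
    and \<epsilon>'_cont: "continuous_on {t\<^sub>0..} \<epsilon>'"
    and \<epsilon>_lim: "(\<epsilon> \<longlongrightarrow> 0) at_top"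
    and slow: "((\<lambda>t. \<epsilon>' t / (\<epsilon> t)\<^sup>2) \<longlongrightarrow> 0) at_top"
    and zero: "B z = 0"
    and x_deriv: "\<And>t. t \<ge> t\<^sub>0 \<Longrightarrow> (x has_vector_derivative v t) (at t within {t\<^sub>0..})"
    and v_ac: "loc_abs_continuous t\<^sub>0 v"
    and N: "negligible N"
    and ode: "\<And>t. t \<ge> t\<^sub>0 \<Longrightarrow> t \<notin> N \<Longrightarrow>
      \<exists>a w. (v has_vector_derivative a) (at t within {t\<^sub>0..}) \<and>
        ((\<lambda>s. B (x s) + \<epsilon> s *\<^sub>R x s) has_vector_derivative w) (at t within {t\<^sub>0..}) \<and>
        a + ((\<gamma> + d) * sqrt (\<epsilon> t)) *\<^sub>R v t + (1 / (\<gamma> * sqrt (\<epsilon> t))) *\<^sub>R w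
          + B (x t) + \<epsilon> t *\<^sub>R x t = 0"
begin

text \<open>
  Here \<open>r q = - q' / q\<^sup>2\<close>. In the time scale \<open>d\<tau> = q dt\<close> the equation is the first-order system
  \<open>x\<^sub>\<tau> = V - F / (\<gamma> \<epsilon>)\<close>, \<open>V\<^sub>\<tau> = - (\<gamma> - 2 r q) V - (d + r q) x\<^sub>\<tau>\<close>.
\<close>

definition q :: "real \<Rightarrow> real" where "q t = sqrt (\<epsilon> t)"
definition r :: "real \<Rightarrow> real" where "r t = - (\<epsilon>' t / (\<epsilon> t)\<^sup>2) / 2"
definition F :: "real \<Rightarrow> 'a" where "F t = B (x t) + \<epsilon> t *\<^sub>R x t"
definition V :: "real \<Rightarrow> 'a" where "V t = (1 / q t) *\<^sub>R v t + (1 / (\<gamma> * \<epsilon> t)) *\<^sub>R F t"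
definition y :: "real \<Rightarrow> 'a" where "y t = tikhonov B (\<epsilon> t)"
text \<open>The anchor is a parameter, so that time derivatives can be taken with \<open>p\<close>
  frozen at \<open>y t\<close> and the motion of \<open>y\<close> charged separately.\<close>

definition lyap :: "'a \<Rightarrow> real \<Rightarrow> real" where
  "lyap p t = \<gamma> * d / 2 * (norm (x t - p))\<^sup>2 + 1 / 2 * (norm (V t + d *\<^sub>R (x t - p)))\<^sup>2"
definition lyap_rate :: "'a \<Rightarrow> real \<Rightarrow> real" where
  "lyap_rate p t = \<gamma> * d * ((x t - p) \<bullet> v t) + (V t + d *\<^sub>R (x t - p)) \<bullet>
    (- ((\<gamma> - 2 * (r t * q t)) * q t) *\<^sub>R V t - (r t * q t) *\<^sub>R v t)"

section \<open>The coefficients and the derivatives along the flow\<close>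

lemma q_pos: "t \<ge> t\<^sub>0 \<Longrightarrow> q t > 0"
  using \<epsilon>_pos by (simp add: q_def)

lemma q_sq: "t \<ge> t\<^sub>0 \<Longrightarrow> (q t)\<^sup>2 = \<epsilon> t"
  using \<epsilon>_pos[of t] by (simp add: q_def)

lemma \<epsilon>'_eq: "t \<ge> t\<^sub>0 \<Longrightarrow> \<epsilon>' t = - 2 * r t * (q t) ^ 4"
  using \<epsilon>_pos[of t] q_sq[of t] unfolding r_def power4_eq_xxxx
  by (simp add: field_simps power2_eq_square)

lemma \<epsilon>'_nonpos:
  assumes t: "t \<ge> t\<^sub>0"
  shows "\<epsilon>' t \<le> 0"
proof -
  have "(\<epsilon> has_real_derivative \<epsilon>' t) (at t within {t..})"
    by (rule has_field_derivative_subset[OF \<epsilon>_deriv[OF t]]) (use t in auto)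
  then have "((\<lambda>s. (\<epsilon> s - \<epsilon> t) / (s - t)) \<longlongrightarrow> \<epsilon>' t) (at_right t)"
    unfolding has_field_derivative_iff at_within_Ici_at_right .
  then show ?thesis
  proof (rule tendsto_upperbound)
    have "(\<epsilon> s - \<epsilon> t) / (s - t) \<le> 0" if "s > t" for s
      using monotone_onD[OF \<epsilon>_antimono, of t s] that t by (intro divide_nonpos_pos) auto
    then show "\<forall>\<^sub>F s in at_right t. (\<epsilon> s - \<epsilon> t) / (s - t) \<le> 0"
      by (simp add: eventually_at_filter)
  qed simp
qed

lemma r_nonneg: "t \<ge> t\<^sub>0 \<Longrightarrow> r t \<ge> 0"
  using \<epsilon>'_nonpos[of t] by (simp add: r_def divide_nonpos_nonneg)

lemma inv_q_deriv:
  assumes t: "t \<ge> t\<^sub>0"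
  shows "((\<lambda>s. 1 / q s) has_real_derivative r t * q t) (at t within {t\<^sub>0..})"
proof -
  have "((\<lambda>s. 1 / q s) has_real_derivative - (\<epsilon>' t * (inverse (q t) / 2)) / (q t * q t)) (at t within {t\<^sub>0..})"
    unfolding q_def using \<epsilon>_pos[OF t]
    by (auto intro!: derivative_eq_intros \<epsilon>_deriv[OF t] simp: mult_ac)
  moreover have "- (\<epsilon>' t * (inverse (q t) / 2)) / (q t * q t) = r t * q t"
    unfolding \<epsilon>'_eq[OF t] using q_pos[OF t] by (simp add: field_simps power4_eq_xxxx)
  ultimately show ?thesis by simp
qed

lemma inv_\<epsilon>_deriv:
  assumes t: "t \<ge> t\<^sub>0"
  shows "((\<lambda>s. 1 / (\<gamma> * \<epsilon> s)) has_real_derivative 2 * r t / \<gamma>) (at t within {t\<^sub>0..})"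
proof -
  have "((\<lambda>s. 1 / (\<gamma> * \<epsilon> s)) has_real_derivative
      - (\<gamma> * \<epsilon>' t) / ((\<gamma> * \<epsilon> t) * (\<gamma> * \<epsilon> t))) (at t within {t\<^sub>0..})"
    using \<epsilon>_pos[OF t] pos by (auto intro!: derivative_eq_intros \<epsilon>_deriv[OF t])
  moreover have "- (\<gamma> * \<epsilon>' t) / ((\<gamma> * \<epsilon> t) * (\<gamma> * \<epsilon> t)) = 2 * r t / \<gamma>"
    unfolding r_def using \<epsilon>_pos[OF t] pos by (simp add: field_simps power2_eq_square)
  ultimately show ?thesis by simp
qed

lemma ln_\<epsilon>_deriv:
  assumes t: "t \<ge> t\<^sub>0"
  shows "((\<lambda>s. ln (\<epsilon> s)) has_real_derivative \<epsilon>' t / \<epsilon> t) (at t within {t\<^sub>0..})"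
  using \<epsilon>_pos[OF t] by (auto intro!: derivative_eq_intros \<epsilon>_deriv[OF t])

text \<open>Dividing the equation by \<open>q t\<close> turns the coefficient of \<open>w\<close>
  into \<open>1 / (\<gamma> * \<epsilon> t)\<close>, the factor of \<open>F\<close> in
  \<open>V\<close>; hence \<open>w\<close> cancels.\<close>

lemma V_deriv:
  assumes t: "t \<ge> t\<^sub>0" "t \<notin> N"
  shows "(V has_vector_derivative
    - ((\<gamma> - 2 * (r t * q t)) * q t) *\<^sub>R V t - (d + r t * q t) *\<^sub>R v t) (at t within {t\<^sub>0..})"
proof -
  note q = q_pos[OF t(1)]
  obtain a w where a: "(v has_vector_derivative a) (at t within {t\<^sub>0..})"
    and w: "(F has_vector_derivative w) (at t within {t\<^sub>0..})"
    and eq: "a + ((\<gamma> + d) * q t) *\<^sub>R v t + (1 / (\<gamma> * q t)) *\<^sub>R w + F t = 0"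
    using ode[OF t] unfolding F_def q_def by (auto simp: add.assoc)
  have V: "(V has_vector_derivative ((1 / q t) *\<^sub>R a + (r t * q t) *\<^sub>R v t)
      + ((1 / (\<gamma> * \<epsilon> t)) *\<^sub>R w + (2 * r t / \<gamma>) *\<^sub>R F t)) (at t within {t\<^sub>0..})"
    unfolding V_def
    by (intro has_vector_derivative_add has_vector_derivative_scaleR a w inv_q_deriv inv_\<epsilon>_deriv t)
  have a_eq: "a = - (((\<gamma> + d) * q t) *\<^sub>R v t) - (1 / (\<gamma> * q t)) *\<^sub>R w - F t"
    using eq by (simp add: algebra_simps eq_neg_iff_add_eq_0)
  have "(1 / q t) *\<^sub>R a = - ((\<gamma> + d) *\<^sub>R v t) - (1 / (\<gamma> * \<epsilon> t)) *\<^sub>R w - (1 / q t) *\<^sub>R F t"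
    unfolding a_eq q_sq[OF t(1), symmetric] using q
    by (simp add: scaleR_diff_right power2_eq_square)
  then have eq1: "((1 / q t) *\<^sub>R a + (r t * q t) *\<^sub>R v t) + ((1 / (\<gamma> * \<epsilon> t)) *\<^sub>R w + (2 * r t / \<gamma>) *\<^sub>R F t)
      = (r t * q t - (\<gamma> + d)) *\<^sub>R v t + (2 * r t / \<gamma> - 1 / q t) *\<^sub>R F t"
    by (simp add: algebra_simps)
  \<comment> \<open>This multiple of \<open>V t\<close> carries exactly the remaining coefficient of
    \<open>F t\<close>, so \<open>F t\<close> is eliminated and only a multiple of
    \<open>v t\<close> is left over.\<close>
  have "- ((\<gamma> - 2 * (r t * q t)) * q t) *\<^sub>R V t
      = (- ((\<gamma> - 2 * (r t * q t)) * q t) * (1 / q t)) *\<^sub>R v t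
        + (- ((\<gamma> - 2 * (r t * q t)) * q t) * (1 / (\<gamma> * (q t)\<^sup>2))) *\<^sub>R F t"
    unfolding V_def q_sq[OF t(1)] by (simp only: scaleR_add_right scaleR_scaleR)
  also have "- ((\<gamma> - 2 * (r t * q t)) * q t) * (1 / q t) = - (\<gamma> - 2 * (r t * q t))"
    using q by simp
  also have "- ((\<gamma> - 2 * (r t * q t)) * q t) * (1 / (\<gamma> * (q t)\<^sup>2)) = 2 * r t / \<gamma> - 1 / q t"
    using q pos by (simp add: field_simps power2_eq_square)
  finally have "- ((\<gamma> - 2 * (r t * q t)) * q t) *\<^sub>R V t
      = (- (\<gamma> - 2 * (r t * q t))) *\<^sub>R v t + (2 * r t / \<gamma> - 1 / q t) *\<^sub>R F t" .
  moreover have "X - c *\<^sub>R u = (a - c) *\<^sub>R u + b *\<^sub>R u'" if "X = a *\<^sub>R u + b *\<^sub>R u'"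
    for X u u' :: 'a and a b c :: real
    using that by (simp add: algebra_simps)
  ultimately have "- ((\<gamma> - 2 * (r t * q t)) * q t) *\<^sub>R V t - (d + r t * q t) *\<^sub>R v t
      = (- (\<gamma> - 2 * (r t * q t)) - (d + r t * q t)) *\<^sub>R v t + (2 * r t / \<gamma> - 1 / q t) *\<^sub>R F t"
    by blast
  also have "- (\<gamma> - 2 * (r t * q t)) - (d + r t * q t) = r t * q t - (\<gamma> + d)" by simp
  finally have "- ((\<gamma> - 2 * (r t * q t)) * q t) *\<^sub>R V t - (d + r t * q t) *\<^sub>R v t
      = (r t * q t - (\<gamma> + d)) *\<^sub>R v t + (2 * r t / \<gamma> - 1 / q t) *\<^sub>R F t" .
  then show ?thesis using V eq1 by simp
qed

lemma lyap_deriv: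
  assumes t: "t \<ge> t\<^sub>0" "t \<notin> N"
  shows "(lyap p has_real_derivative lyap_rate p t) (at t within {t\<^sub>0..})"
proof -
  let ?e = "\<lambda>s. x s - p" and ?U = "\<lambda>s. V s + d *\<^sub>R (x s - p)"
  let ?V' = "- ((\<gamma> - 2 * (r t * q t)) * q t) *\<^sub>R V t - (d + r t * q t) *\<^sub>R v t"
  have e: "(?e has_vector_derivative v t) (at t within {t\<^sub>0..})"
    using has_vector_derivative_diff[OF x_deriv[OF t(1)] has_vector_derivative_const[of p]] by simp
  have U: "(?U has_vector_derivative ?V' + d *\<^sub>R v t) (at t within {t\<^sub>0..})"
    using has_vector_derivative_add[OF V_deriv[OF t]
        bounded_linear.has_vector_derivative[OF bounded_linear_scaleR_right e]] .
  note inner = bounded_bilinear.has_vector_derivative[OF bounded_bilinear_inner]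
  have "((\<lambda>s. \<gamma> * d / 2 * (?e s \<bullet> ?e s) + 1 / 2 * (?U s \<bullet> ?U s)) has_real_derivative
      \<gamma> * d / 2 * (?e t \<bullet> v t + v t \<bullet> ?e t)
      + 1 / 2 * (?U t \<bullet> (?V' + d *\<^sub>R v t) + (?V' + d *\<^sub>R v t) \<bullet> ?U t)) (at t within {t\<^sub>0..})"
    using inner[OF e e] inner[OF U U]
    unfolding has_real_derivative_iff_has_vector_derivative[symmetric]
    by (intro DERIV_add DERIV_cmult)
  moreover have "\<gamma> * d / 2 * (?e t \<bullet> v t + v t \<bullet> ?e t)
      + 1 / 2 * (?U t \<bullet> (?V' + d *\<^sub>R v t) + (?V' + d *\<^sub>R v t) \<bullet> ?U t) = lyap_rate p t"
  proof -
    \<comment> \<open>The derivative of the shift \<open>d *\<^sub>R (x s - p)\<close> cancels the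
      part \<open>- d *\<^sub>R v t\<close>.\<close>
    have V': "?V' + d *\<^sub>R v t
        = - ((\<gamma> - 2 * (r t * q t)) * q t) *\<^sub>R V t - (r t * q t) *\<^sub>R v t"
      by (simp add: algebra_simps)
    show ?thesis unfolding lyap_rate_def V'
      by (simp add: inner_commute[of _ "x t - p"] inner_commute[of _ "V t + d *\<^sub>R (x t - p)"])
  qed
  ultimately show ?thesis
    unfolding lyap_def[abs_def] power2_norm_eq_inner by simp
qed

lemma y_dist_le:
  assumes "s \<ge> t\<^sub>0" "t \<ge> t\<^sub>0"
  shows "norm (y s - y t) \<le> norm z * \<bar>ln (\<epsilon> s) - ln (\<epsilon> t)\<bar>"
proof (cases "\<epsilon> s \<le> \<epsilon> t")
  case True
  then have "norm (y t - y s) \<le> (ln (\<epsilon> t) - ln (\<epsilon> s)) * norm z"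
    unfolding y_def using tikhonov_dist_le_ratio[OF coco pos(1) \<epsilon>_pos[OF assms(1)] _ zero] by blast
  also have "\<dots> \<le> \<bar>ln (\<epsilon> s) - ln (\<epsilon> t)\<bar> * norm z" by (intro mult_right_mono) auto
  finally show ?thesis by (simp add: norm_minus_commute mult.commute)
next
  case False
  then have "norm (y s - y t) \<le> (ln (\<epsilon> s) - ln (\<epsilon> t)) * norm z"
    unfolding y_def using tikhonov_dist_le_ratio[OF coco pos(1) \<epsilon>_pos[OF assms(2)] _ zero, of "\<epsilon> s"]
    by simp
  also have "\<dots> \<le> \<bar>ln (\<epsilon> s) - ln (\<epsilon> t)\<bar> * norm z" by (intro mult_right_mono) auto
  finally show ?thesis by (simp add: mult.commute)
qed

text \<open>Both squares are factored as \<open>(a + b) \<bullet> (a - b)\<close>. The norms of sums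
  are kept because, as the two anchors merge, they tend to exactly the factor in the drift.\<close>

lemma lyap_anchor_diff:
  "lyap p t - lyap p' t \<le> (\<gamma> * d / 2 * norm ((x t - p) + (x t - p'))
    + d / 2 * norm ((V t + d *\<^sub>R (x t - p)) + (V t + d *\<^sub>R (x t - p')))) * norm (p - p')"
proof -
  have sq: "(norm a)\<^sup>2 - (norm b)\<^sup>2 \<le> norm (a + b) * norm (a - b)" for a b :: 'a
  proof -
    have "(norm a)\<^sup>2 - (norm b)\<^sup>2 = (a + b) \<bullet> (a - b)"
      by (simp add: power2_norm_eq_inner inner_add_left inner_diff_right inner_add_right inner_diff_left inner_commute)
    then show ?thesis using norm_cauchy_schwarz by metis
  qed
  have 1: "\<gamma> * d / 2 * ((norm (x t - p))\<^sup>2 - (norm (x t - p'))\<^sup>2)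
      \<le> \<gamma> * d / 2 * (norm ((x t - p) + (x t - p')) * norm (p - p'))"
    using sq[of "x t - p" "x t - p'"] pos by (intro mult_left_mono) (auto simp: norm_minus_commute)
  have "V t + d *\<^sub>R (x t - p) - (V t + d *\<^sub>R (x t - p')) = d *\<^sub>R (p' - p)"
    by (simp add: algebra_simps)
  then have "norm (V t + d *\<^sub>R (x t - p) - (V t + d *\<^sub>R (x t - p'))) = d * norm (p - p')"
    using pos by (simp add: norm_minus_commute)
  then have 2: "(norm (V t + d *\<^sub>R (x t - p)))\<^sup>2 - (norm (V t + d *\<^sub>R (x t - p')))\<^sup>2
      \<le> norm ((V t + d *\<^sub>R (x t - p)) + (V t + d *\<^sub>R (x t - p'))) * (d * norm (p - p'))"
    using sq by metis
  show ?thesis using 1 2 unfolding lyap_def by (simp add: algebra_simps)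
qed

text \<open>
  The cost of moving the anchor \<open>y\<close>, which is Lipschitz in \<open>ln \<epsilon>\<close> but need not be differentiable.
\<close>

definition drift :: "real \<Rightarrow> real" where
  "drift t = (\<gamma> * d * norm (x t - y t) + d * norm (V t + d *\<^sub>R (x t - y t)))
    * (norm z * \<bar>\<epsilon>' t / \<epsilon> t\<bar>)"

lemma q_tendsto: "(q \<longlongrightarrow> 0) at_top"
  unfolding q_def using tendsto_real_sqrt[OF \<epsilon>_lim] by simp

lemma r_tendsto: "(r \<longlongrightarrow> 0) at_top"
  unfolding r_def using tendsto_divide[OF tendsto_minus[OF slow] tendsto_const[of 2]] by simp

text \<open>The rate \<open>c\<close> is fixed before \<open>k\<close>, so it does not degrade as
  the level \<open>k\<close> shrinks. Since \<open>r\<close> and \<open>q\<close> tend to 0, the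
  smallness conditions hold eventually; only the starting time depends on \<open>k\<close>.\<close>

lemma lyap_decay:
  "\<exists>c>0. \<forall>k>0. \<exists>T\<ge>t\<^sub>0. \<forall>t\<ge>T. lyap_rate (y t) t + drift t \<le> - c * q t * (lyap (y t) t - k)"
proof -
  define m where "m = min (\<gamma> / 2) (d / (2 * d\<^sup>2 + 1))"
  have d2: "2 * d\<^sup>2 + 1 > 0" using zero_le_power2[of d] by linarith
  have m: "m > 0" "2 * m \<le> \<gamma>" using pos d2 by (auto simp: m_def)
  have m': "m * (2 * d\<^sup>2 + 1) \<le> d"
    using d2 by (simp add: m_def pos_le_divide_eq[symmetric])
  define c where "c = m / (2 * (\<gamma> * d + 1))"
  have "\<gamma> * d > 0" using pos by simp
  then have c: "c > 0" using m unfolding c_def by (intro divide_pos_pos) auto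
  have "\<exists>T\<ge>t\<^sub>0. \<forall>t\<ge>T. lyap_rate (y t) t + drift t \<le> - c * q t * (lyap (y t) t - k)" if k: "k > 0" for k
  proof -
    let ?f = "\<lambda>t. r t * q t * (1 / \<gamma> + d) + r t * q t + (r t)\<^sup>2 / (4 * \<gamma>\<^sup>2 * d * \<beta>)"
    let ?K = "(2 * norm z * \<gamma> * d)\<^sup>2 + (2 * norm z * d)\<^sup>2"
    let ?g = "\<lambda>t. (r t * q t)\<^sup>2 * ?K / m"
    have "(?f \<longlongrightarrow> 0 * 0 * (1 / \<gamma> + d) + 0 * 0 + 0\<^sup>2 / (4 * \<gamma>\<^sup>2 * d * \<beta>)) at_top"
      using pos by (intro tendsto_intros r_tendsto q_tendsto) auto
    then have f: "\<forall>\<^sub>F t in at_top. ?f t < m / 2" using order_tendstoD(2)[of ?f 0 at_top "m / 2"] m by simp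
    have "(?g \<longlongrightarrow> (0 * 0)\<^sup>2 * ?K / m) at_top"
      using m by (intro tendsto_intros r_tendsto q_tendsto) auto
    then have g: "\<forall>\<^sub>F t in at_top. ?g t < c * k" using order_tendstoD(2)[of ?g 0 at_top "c * k"] c k by simp
    have "\<forall>\<^sub>F t in at_top. lyap_rate (y t) t + drift t \<le> - c * q t * (lyap (y t) t - k)"
      using f g eventually_ge_at_top[of t\<^sub>0]
    proof eventually_elim
      case (elim t)
      have t: "t \<ge> t\<^sub>0" by fact
      let ?e = "x t - y t" and ?b = "B (x t) - B (y t)"
      let ?U = "V t + d *\<^sub>R ?e"
      have coco_t: "\<beta> * (?b \<bullet> ?b) \<le> ?e \<bullet> ?b"
        using coco by (simp add: cocoercive_def power2_norm_eq_inner)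
      \<comment> \<open>The Tikhonov equation removes the inhomogeneous term: \<open>F t\<close>
        becomes a function of the error and the increment of \<open>B\<close>.\<close>
      have "B (y t) = - (\<epsilon> t *\<^sub>R y t)"
        unfolding y_def by (rule tikhonov_eq[OF coco pos(1) \<epsilon>_pos[OF t]])
      then have F_eq: "?b + \<epsilon> t *\<^sub>R ?e = F t"
        unfolding F_def by (simp add: algebra_simps)
      have v_eq: "v t = q t *\<^sub>R (?U - d *\<^sub>R ?e - (1 / (\<gamma> * (q t)\<^sup>2)) *\<^sub>R (?b + (q t)\<^sup>2 *\<^sub>R ?e))"
        unfolding q_sq[OF t] F_eq using q_pos[OF t] by (simp add: V_def)
      have V_eq: "V t = ?U - d *\<^sub>R ?e" by simp
      \<comment> \<open>The anchor moves more slowly than the decay scale \<open>q t\<close>, by the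
        vanishing factor \<open>r t * q t\<close>.\<close>
      have "\<bar>\<epsilon>' t / \<epsilon> t\<bar> = 2 * (r t * q t) * q t"
      proof -
        have "\<epsilon>' t / \<epsilon> t = - (2 * (r t * q t) * q t)"
          unfolding \<epsilon>'_eq[OF t] q_sq[OF t, symmetric] using q_pos[OF t]
          by (simp add: power4_eq_xxxx power2_eq_square)
        then show ?thesis using r_nonneg[OF t] q_pos[OF t] by simp
      qed
      then have drift_eq: "drift t = (\<gamma> * d * norm ?e + d * norm ?U) * (2 * (r t * q t) * q t * norm z)"
        by (simp add: drift_def mult_ac)
      have "\<gamma> * d * (?e \<bullet> v t) + ?U \<bullet> (- ((\<gamma> - 2 * (r t * q t)) * q t) *\<^sub>R (?U - d *\<^sub>R ?e) - (r t * q t) *\<^sub>R v t)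
          + (\<gamma> * d * norm ?e + d * norm ?U) * (2 * (r t * q t) * q t * norm z)
        \<le> - c * q t * (\<gamma> * d / 2 * (norm ?e)\<^sup>2 + 1 / 2 * (norm ?U)\<^sup>2 - k)"
        by (rule lyapunov_decay[OF q_pos[OF t] pos r_nonneg[OF t] norm_ge_zero coco_t v_eq m(2) m' m(1)
              _ c_def]) (use elim in auto)
      then show ?case unfolding V_eq[symmetric] drift_eq[symmetric] lyap_rate_def lyap_def .
    qed
    then obtain T where "\<forall>t\<ge>T. lyap_rate (y t) t + drift t \<le> - c * q t * (lyap (y t) t - k)"
      unfolding eventually_at_top_linorder by blast
    then show ?thesis by (intro exI[of _ "max T t\<^sub>0"]) simp
  qed
  then show ?thesis using c by blast
qed

section \<open>Regularity in time and integration of the decay estimate\<close>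

lemma \<epsilon>_cont: "continuous_on {t\<^sub>0..} \<epsilon>"
  by (rule DERIV_continuous_on[OF \<epsilon>_deriv]) simp

lemma q_cont: "continuous_on {t\<^sub>0..} q"
  unfolding q_def by (intro continuous_intros \<epsilon>_cont)

lemma r_cont: "continuous_on {t\<^sub>0..} r"
  unfolding r_def by (intro continuous_intros \<epsilon>_cont \<epsilon>'_cont) ((use \<epsilon>_pos in force)+)

lemma v_abs_continuous:
  assumes "t\<^sub>0 \<le> T" "T < b"
  shows "abs_continuous_on_interval T b v"
  using v_ac abs_continuous_on_interval_subset[of t\<^sub>0 b v T b] assms
  by (simp add: loc_abs_continuous_def)

lemma dominated_on_real_C1:
  assumes "t\<^sub>0 \<le> T" "\<And>t. t \<ge> t\<^sub>0 \<Longrightarrow> (f has_real_derivative f' t) (at t within {t\<^sub>0..})"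
    "continuous_on {t\<^sub>0..} f'"
  shows "dominated_on h {T..b} f"
proof (rule dominated_on_C1)
  have sub: "{T..b} \<subseteq> {t\<^sub>0..}" using assms(1) by auto
  show "(f has_vector_derivative f' t) (at t within {T..b})" if "t \<in> {T..b}" for t
    using has_field_derivative_subset[OF assms(2) sub, of t] that sub
    unfolding has_real_derivative_iff_has_vector_derivative by auto
  show "continuous_on {T..b} f'" by (rule continuous_on_subset[OF assms(3) sub])
qed

text \<open>Absolute continuity enters only through \<open>v\<close>: \<open>x\<close> and the
  coefficients are continuously differentiable, \<open>B\<close> is Lipschitz, and \<open>y\<close>
  is Lipschitz in \<open>ln \<epsilon>\<close>.\<close>

lemma dominated_on_flow:
  assumes T: "t\<^sub>0 \<le> T" "T < b"
  shows "dominated_on v {T..b} x" "dominated_on v {T..b} V" "dominated_on v {T..b} y"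
proof -
  have sub: "{T..b} \<subseteq> {t\<^sub>0..}" using T by auto
  have v_cont: "continuous_on {T..b} v"
    by (rule abs_continuous_on_interval_continuous_on[OF v_abs_continuous[OF T]])
  have dv: "dominated_on v {T..b} v"
    by (intro dominated_on_self compact_imp_bounded compact_continuous_image v_cont compact_Icc)
  show dx: "dominated_on v {T..b} x"
  proof (rule dominated_on_C1[OF _ v_cont])
    show "(x has_vector_derivative v t) (at t within {T..b})" if "t \<in> {T..b}" for t
      using has_vector_derivative_within_subset[OF x_deriv sub] that sub by auto
  qed
  have dB: "dominated_on v {T..b} (\<lambda>t. B (x t))"
    by (rule dominated_on_lipschitz[OF dx, of "1 / \<beta>"])
      (use cocoercive_lipschitz[OF coco pos(1)] pos in auto)
  have d\<epsilon>: "dominated_on v {T..b} \<epsilon>"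
    by (rule dominated_on_real_C1[OF T(1) \<epsilon>_deriv \<epsilon>'_cont])
  have dF: "dominated_on v {T..b} F"
    unfolding F_def[abs_def] by (intro dominated_on_add dominated_on_scaleR dB d\<epsilon> dx)
  have "dominated_on v {T..b} (\<lambda>t. 1 / q t)"
    by (rule dominated_on_real_C1[OF T(1) inv_q_deriv], assumption) (intro continuous_intros r_cont q_cont)
  moreover have "dominated_on v {T..b} (\<lambda>t. 1 / (\<gamma> * \<epsilon> t))"
    by (rule dominated_on_real_C1[OF T(1) inv_\<epsilon>_deriv], assumption)
      (use pos in \<open>intro continuous_intros r_cont, auto\<close>)
  ultimately show "dominated_on v {T..b} V"
    unfolding V_def[abs_def] by (intro dominated_on_add dominated_on_scaleR dv dF)
  have "dominated_on v {T..b} (\<lambda>t. ln (\<epsilon> t))"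
    by (rule dominated_on_real_C1[OF T(1) ln_\<epsilon>_deriv], assumption)
      (intro continuous_intros \<epsilon>_cont \<epsilon>'_cont, use \<epsilon>_pos in force)
  then show "dominated_on v {T..b} y"
    by (rule dominated_on_lipschitz[of _ _ _ "norm z"]) (use y_dist_le sub in auto)
qed

text \<open>Gronwall with the integrating factor \<open>E\<close>: the decay estimate says that
  \<open>g\<close> should not increase. As \<open>g\<close> contains the moving anchor, this is read
  off from upper bounds on its difference quotients.\<close>

lemma lyap_comparison:
  assumes T: "t\<^sub>0 \<le> T" "T \<le> b"
    and decay: "\<And>t. T \<le> t \<Longrightarrow> lyap_rate (y t) t + drift t \<le> - c * q t * (lyap (y t) t - k)"
  shows "exp (c * integral {t\<^sub>0..b} q) * (lyap (y b) b - k)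
    \<le> exp (c * integral {t\<^sub>0..T} q) * (lyap (y T) T - k)"
proof (cases "T = b")
  case False
  then have Tb: "T < b" using T by simp
  have sub: "{T..b} \<subseteq> {t\<^sub>0..}" using T by auto
  define E where "E t = exp (c * integral {t\<^sub>0..t} q)" for t
  have E_deriv: "(E has_real_derivative E t * (c * q t)) (at t within {T..b})" if t: "t \<in> {T..b}" for t
  proof -
    have "((\<lambda>u. integral {t\<^sub>0..u} q) has_real_derivative q t) (at t within {t\<^sub>0..b})"
      unfolding has_real_derivative_iff_has_vector_derivative
      by (rule integral_has_vector_derivative)
        (use continuous_on_subset[OF q_cont, of "{t\<^sub>0..b}"] t T in auto)
    then have "((\<lambda>u. integral {t\<^sub>0..u} q) has_real_derivative q t) (at t within {T..b})"
      by (rule has_field_derivative_subset) (use T in auto)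
    then show ?thesis unfolding E_def by (auto intro!: derivative_eq_intros)
  qed
  have E_cont: "continuous_on {T..b} E" by (rule DERIV_continuous_on[OF E_deriv])
  have dE: "dominated_on v {T..b} E"
  proof (rule dominated_on_C1)
    show "(E has_vector_derivative E t * (c * q t)) (at t within {T..b})" if "t \<in> {T..b}" for t
      using E_deriv[OF that] by (simp add: has_real_derivative_iff_has_vector_derivative)
    show "continuous_on {T..b} (\<lambda>t. E t * (c * q t))"
      by (intro continuous_intros E_cont continuous_on_subset[OF q_cont sub])
  qed
  note flow = dominated_on_flow[OF T(1) Tb]
  define g where "g t = E t * (lyap (y t) t - k)" for t
  have "dominated_on v {T..b} (\<lambda>t. lyap (y t) t)"
    unfolding lyap_def power2_norm_eq_inner
    by (intro dominated_on_add dominated_on_mult dominated_on_inner dominated_on_diff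
        dominated_on_scaleR dominated_on_const flow)
  then have dg: "dominated_on v {T..b} g"
    unfolding g_def[abs_def] by (intro dominated_on_mult dominated_on_diff dominated_on_const dE)
  have "g b \<le> g T"
  proof (rule abs_continuous_comparison[OF T(2) v_abs_continuous[OF T(1) Tb] dg N])
    fix t e :: real assume t: "t \<in> {T..b}" "t \<notin> N" and e: "e > 0"
    have t0: "t \<ge> t\<^sub>0" using t T by auto
    let ?at = "at t within {T..b}"
    define p where "p = y t"
    define R where "R s = \<gamma> * d / 2 * norm ((x s - y s) + (x s - p))
      + d / 2 * norm ((V s + d *\<^sub>R (x s - y s)) + (V s + d *\<^sub>R (x s - p)))" for s
    \<comment> \<open>The product rule for difference quotients, with the change of anchor replaced
      by its bound. This majorant of the quotient of \<open>g\<close> has a limit at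
      \<open>t\<close>, which is nonpositive by the decay estimate.\<close>
    define H where "H s = E s * ((lyap p s - lyap p t) / (s - t)
        + R s * (norm z * \<bar>(ln (\<epsilon> s) - ln (\<epsilon> t)) / (s - t)\<bar>))
      + (lyap p t - k) * ((E s - E t) / (s - t))" for s
    have ln_lim: "((\<lambda>s. (ln (\<epsilon> s) - ln (\<epsilon> t)) / (s - t)) \<longlongrightarrow> \<epsilon>' t / \<epsilon> t) ?at"
      using has_field_derivative_subset[OF ln_\<epsilon>_deriv[OF t0] sub]
      by (simp add: has_field_derivative_iff)
    have lyap_lim: "((\<lambda>s. (lyap p s - lyap p t) / (s - t)) \<longlongrightarrow> lyap_rate p t) ?at"
      using has_field_derivative_subset[OF lyap_deriv[OF t0 t(2)] sub]
      by (simp add: has_field_derivative_iff)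
    have E_lim: "((\<lambda>s. (E s - E t) / (s - t)) \<longlongrightarrow> E t * (c * q t)) ?at"
      using E_deriv[OF t(1)] by (simp add: has_field_derivative_iff)
    have E_tendsto: "(E \<longlongrightarrow> E t) ?at" using E_cont t by (simp add: continuous_on_def)
    have x_tendsto: "(x \<longlongrightarrow> x t) ?at"
      using has_vector_derivative_continuous[OF has_vector_derivative_within_subset[OF x_deriv[OF t0] sub]]
      by (simp add: continuous_within)
    have V_tendsto: "(V \<longlongrightarrow> V t) ?at"
      using has_vector_derivative_continuous[OF has_vector_derivative_within_subset[OF V_deriv[OF t0 t(2)] sub]]
      by (simp add: continuous_within)
    have ln_tendsto: "((\<lambda>s. ln (\<epsilon> s)) \<longlongrightarrow> ln (\<epsilon> t)) ?at"
      using DERIV_continuous[OF has_field_derivative_subset[OF ln_\<epsilon>_deriv[OF t0] sub]]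
      by (simp add: continuous_within)
    have in_S: "\<forall>\<^sub>F s in ?at. s \<in> {T..b} \<and> s \<noteq> t" by (auto simp: eventually_at_filter)
    have y_tendsto: "(y \<longlongrightarrow> p) ?at"
    proof (rule LIM_zero_cancel, rule Lim_null_comparison)
      show "\<forall>\<^sub>F s in ?at. norm (y s - p) \<le> norm z * \<bar>ln (\<epsilon> s) - ln (\<epsilon> t)\<bar>"
        using in_S by eventually_elim (use y_dist_le[OF _ t0] T in \<open>auto simp: p_def\<close>)
      have "((\<lambda>s. norm z * \<bar>ln (\<epsilon> s) - ln (\<epsilon> t)\<bar>) \<longlongrightarrow> norm z * \<bar>ln (\<epsilon> t) - ln (\<epsilon> t)\<bar>) ?at"
        by (intro tendsto_intros ln_tendsto)
      then show "((\<lambda>s. norm z * \<bar>ln (\<epsilon> s) - ln (\<epsilon> t)\<bar>) \<longlongrightarrow> 0) ?at" by simp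
    qed
    have R_tendsto: "(R \<longlongrightarrow> \<gamma> * d / 2 * norm ((x t - p) + (x t - p))
      + d / 2 * norm ((V t + d *\<^sub>R (x t - p)) + (V t + d *\<^sub>R (x t - p)))) ?at"
      unfolding R_def by (intro tendsto_intros x_tendsto V_tendsto y_tendsto)
    have R_eq: "\<gamma> * d / 2 * norm ((x t - p) + (x t - p))
      + d / 2 * norm ((V t + d *\<^sub>R (x t - p)) + (V t + d *\<^sub>R (x t - p)))
      = \<gamma> * d * norm (x t - p) + d * norm (V t + d *\<^sub>R (x t - p))"
      unfolding scaleR_2[symmetric] by simp
    have H_lim: "(H \<longlongrightarrow> E t * (lyap_rate p t + (\<gamma> * d * norm (x t - p) + d * norm (V t + d *\<^sub>R (x t - p)))
        * (norm z * \<bar>\<epsilon>' t / \<epsilon> t\<bar>)) + (lyap p t - k) * (E t * (c * q t))) ?at"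
      unfolding H_def
      by (intro tendsto_intros E_tendsto lyap_lim R_tendsto[unfolded R_eq] ln_lim E_lim)
    have H_nonpos: "E t * (lyap_rate p t + (\<gamma> * d * norm (x t - p) + d * norm (V t + d *\<^sub>R (x t - p)))
        * (norm z * \<bar>\<epsilon>' t / \<epsilon> t\<bar>)) + (lyap p t - k) * (E t * (c * q t)) \<le> 0"
    proof -
      have "E t * (lyap_rate p t + drift t) \<le> E t * (- c * q t * (lyap p t - k))"
        using decay[of t] t by (intro mult_left_mono) (auto simp: p_def E_def)
      then show ?thesis unfolding drift_def p_def[symmetric] by (simp add: algebra_simps)
    qed
    have "\<forall>\<^sub>F s in ?at. H s < e"
      by (rule order_tendstoD(2)[OF H_lim]) (use H_nonpos e in linarith)
    then show "\<forall>\<^sub>F s in ?at. (g s - g t) / (s - t) \<le> e"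
      using in_S
    proof eventually_elim
      case (elim s)
      have s: "s \<ge> t\<^sub>0" "s \<noteq> t" using elim T by auto
      have R_nonneg: "R s \<ge> 0" using pos by (simp add: R_def)
      \<comment> \<open>Two-sided, since \<open>s\<close> may lie to the left of \<open>t\<close>,
        where division by \<open>s - t\<close> reverses inequalities.\<close>
      have anchor: "\<bar>lyap (y s) s - lyap p s\<bar> \<le> R s * (norm z * \<bar>ln (\<epsilon> s) - ln (\<epsilon> t)\<bar>)"
      proof -
        have "\<bar>lyap (y s) s - lyap p s\<bar> \<le> R s * norm (y s - p)"
          using lyap_anchor_diff[of "y s" s p] lyap_anchor_diff[of p s "y s"]
          by (auto simp: abs_le_iff R_def norm_minus_commute add.commute)
        also have "\<dots> \<le> R s * (norm z * \<bar>ln (\<epsilon> s) - ln (\<epsilon> t)\<bar>)"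
          using y_dist_le[OF s(1) t0] R_nonneg by (intro mult_left_mono) (auto simp: p_def)
        finally show ?thesis .
      qed
      have "(lyap (y s) s - lyap p s) / (s - t) \<le> \<bar>lyap (y s) s - lyap p s\<bar> / \<bar>s - t\<bar>"
        by (metis abs_divide abs_ge_self)
      also have "\<dots> \<le> R s * (norm z * \<bar>ln (\<epsilon> s) - ln (\<epsilon> t)\<bar>) / \<bar>s - t\<bar>"
        by (intro divide_right_mono anchor) simp
      also have "\<dots> = R s * (norm z * \<bar>(ln (\<epsilon> s) - ln (\<epsilon> t)) / (s - t)\<bar>)" by (simp add: abs_divide)
      finally have quot: "(lyap (y s) s - lyap p s) / (s - t)
        \<le> R s * (norm z * \<bar>(ln (\<epsilon> s) - ln (\<epsilon> t)) / (s - t)\<bar>)" .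
      have "(g s - g t) / (s - t) = E s * ((lyap p s - lyap p t) / (s - t)
          + (lyap (y s) s - lyap p s) / (s - t)) + (lyap p t - k) * ((E s - E t) / (s - t))"
        unfolding g_def p_def divide_inverse by (simp add: algebra_simps)
      also have "\<dots> \<le> H s"
        unfolding H_def using quot by (intro add_right_mono mult_left_mono) (auto simp: E_def)
      finally show ?case using elim by simp
    qed
  qed
  then show ?thesis by (simp add: g_def E_def)
qed simp

lemma lyap_tendsto_0:
  assumes "filterlim (\<lambda>t. exp (integral {t\<^sub>0..t} q)) at_top at_top"
  shows "((\<lambda>t. lyap (y t) t) \<longlongrightarrow> 0) at_top"
proof -
  obtain c where c: "c > 0" and decay: "\<And>k. k > 0 \<Longrightarrow>
      \<exists>T\<ge>t\<^sub>0. \<forall>t\<ge>T. lyap_rate (y t) t + drift t \<le> - c * q t * (lyap (y t) t - k)"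
    using lyap_decay by blast
  \<comment> \<open>Passing to the integral itself allows the factor \<open>c\<close>, which may be
    smaller than 1.\<close>
  have "filterlim (\<lambda>t. ln (exp (integral {t\<^sub>0..t} q))) at_top at_top"
    by (rule filterlim_compose[OF ln_at_top assms])
  then have "filterlim (\<lambda>t. c * integral {t\<^sub>0..t} q) at_top at_top"
    by (intro filterlim_tendsto_pos_mult_at_top[OF tendsto_const c]) simp
  then have E: "filterlim (\<lambda>t. exp (c * integral {t\<^sub>0..t} q)) at_top at_top"
    by (rule filterlim_compose[OF exp_at_top])
  show ?thesis
  proof (rule order_tendstoI)
    fix e :: real assume "e < 0"
    moreover have "0 \<le> lyap (y t) t" for t using pos by (simp add: lyap_def)
    ultimately show "\<forall>\<^sub>F t in at_top. e < lyap (y t) t"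
      by (intro always_eventually) (use less_le_trans in blast)
  next
    fix e :: real assume e: "0 < e"
    obtain T where T: "T \<ge> t\<^sub>0"
      "\<And>t. t \<ge> T \<Longrightarrow> lyap_rate (y t) t + drift t \<le> - c * q t * (lyap (y t) t - e / 2)"
      using decay[of "e / 2"] e by auto
    define M where "M = exp (c * integral {t\<^sub>0..T} q) * (lyap (y T) T - e / 2)"
    have "((\<lambda>t. M / exp (c * integral {t\<^sub>0..t} q)) \<longlongrightarrow> 0) at_top"
      by (rule tendsto_divide_0[OF tendsto_const filterlim_at_top_imp_at_infinity[OF E]])
    then have "\<forall>\<^sub>F t in at_top. M / exp (c * integral {t\<^sub>0..t} q) < e / 2"
      using e by (intro order_tendstoD(2)) auto
    then show "\<forall>\<^sub>F t in at_top. lyap (y t) t < e"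
      using eventually_ge_at_top[of T]
    proof eventually_elim
      case (elim t)
      have "exp (c * integral {t\<^sub>0..t} q) * (lyap (y t) t - e / 2) \<le> M"
        unfolding M_def by (rule lyap_comparison[OF T(1) elim(2) T(2)])
      then have "lyap (y t) t - e / 2 \<le> M / exp (c * integral {t\<^sub>0..t} q)"
        by (simp add: pos_le_divide_eq mult.commute)
      then show ?case using elim(1) by linarith
    qed
  qed
qed

theorem flow_tendsto_min_norm:
  assumes "filterlim (\<lambda>t. exp (integral {t\<^sub>0..t} q)) at_top at_top"
  shows "(x \<longlongrightarrow> (ARG_MIN norm z. B z = 0)) at_top"
proof -
  have "((\<lambda>t. sqrt (2 / (\<gamma> * d) * lyap (y t) t)) \<longlongrightarrow> sqrt (2 / (\<gamma> * d) * 0)) at_top"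
    by (intro tendsto_intros lyap_tendsto_0 assms)
  moreover have "norm (x t - y t) \<le> sqrt (2 / (\<gamma> * d) * lyap (y t) t)" for t
  proof (rule real_le_rsqrt)
    have "\<gamma> * d / 2 * (norm (x t - y t))\<^sup>2 \<le> lyap (y t) t" by (simp add: lyap_def)
    then show "(norm (x t - y t))\<^sup>2 \<le> 2 / (\<gamma> * d) * lyap (y t) t"
      using pos by (simp add: field_simps)
  qed
  ultimately have "((\<lambda>t. x t - y t) \<longlongrightarrow> 0) at_top"
    by (intro Lim_null_comparison[of "\<lambda>t. x t - y t"] always_eventually) auto
  moreover have "(y \<longlongrightarrow> (ARG_MIN norm z. B z = 0)) at_top"
    unfolding y_def[abs_def]
  proof (rule filterlim_compose[OF tikhonov_tendsto_min_norm[OF coco pos(1) zero]])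
    show "filterlim \<epsilon> (at_right 0) at_top"
    proof (rule tendsto_imp_filterlim_at_right[OF \<epsilon>_lim])
      show "\<forall>\<^sub>F t in at_top. 0 < \<epsilon> t"
        using eventually_ge_at_top[of t\<^sub>0] by eventually_elim (rule \<epsilon>_pos)
    qed
  qed
  ultimately show ?thesis using tendsto_add[of "\<lambda>t. x t - y t" 0] by fastforce
qed

end

text \<open>Once \<open>\<epsilon> t < 1\<close>, lowering the exponent from \<open>- 2\<close> to
  \<open>- 2 - a\<close> only increases the power, so the given limit dominates.\<close>

lemma powr_slow_imp_square_slow:
  fixes \<epsilon> \<epsilon>' :: "real \<Rightarrow> real"
  assumes "\<forall>\<^sub>F t in at_top. \<epsilon> t > 0" "(\<epsilon> \<longlongrightarrow> 0) at_top" "a \<ge> 0"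
    and "((\<lambda>t. \<epsilon> t powr (- 2 - a) * \<epsilon>' t) \<longlongrightarrow> 0) at_top"
  shows "((\<lambda>t. \<epsilon>' t / (\<epsilon> t)\<^sup>2) \<longlongrightarrow> 0) at_top"
proof (rule Lim_null_comparison)
  have "\<forall>\<^sub>F t in at_top. \<epsilon> t < 1" using order_tendstoD(2)[OF assms(2)] by simp
  then show "\<forall>\<^sub>F t in at_top. norm (\<epsilon>' t / (\<epsilon> t)\<^sup>2) \<le> \<bar>\<epsilon> t powr (- 2 - a) * \<epsilon>' t\<bar>"
    using assms(1)
  proof eventually_elim
    case (elim t)
    have "\<epsilon> t powr (- 2) \<le> \<epsilon> t powr (- 2 - a)"
      using elim assms(3) by (intro powr_mono') auto
    moreover have "\<epsilon> t powr (- 2) = 1 / (\<epsilon> t)\<^sup>2"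
      using elim by (simp add: powr_minus_divide)
    ultimately have "1 / (\<epsilon> t)\<^sup>2 * \<bar>\<epsilon>' t\<bar> \<le> \<epsilon> t powr (- 2 - a) * \<bar>\<epsilon>' t\<bar>"
      by (intro mult_right_mono) auto
    then show ?case by (simp add: abs_mult abs_divide)
  qed
  show "((\<lambda>t. \<bar>\<epsilon> t powr (- 2 - a) * \<epsilon>' t\<bar>) \<longlongrightarrow> 0) at_top"
    using tendsto_rabs[OF assms(4)] by simp
qed

theorem theorem4p3:
  fixes A :: "'a::{real_inner, complete_space} \<Rightarrow> 'a set"
    and \<rho> \<eta> \<delta> \<gamma> t\<^sub>0 :: real
    and \<epsilon> \<epsilon>' \<epsilon>'' :: "real \<Rightarrow> real"
    and x :: "real \<Rightarrow> 'a"
  assumes "max_comonotone \<rho> A"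
    and "zer A \<noteq> {}"
    and "\<eta> > max (- 2 * \<rho>) 0"
    and "\<delta> > 0" and "\<gamma> > 0" and "t\<^sub>0 > 0"
    and "\<And>t. t \<ge> t\<^sub>0 \<Longrightarrow> \<epsilon> t > 0"
    and "antimono_on {t\<^sub>0..} \<epsilon>"
    and "\<And>t. t \<ge> t\<^sub>0 \<Longrightarrow> (\<epsilon> has_real_derivative \<epsilon>' t) (at t within {t\<^sub>0..})"
    and "continuous_on {t\<^sub>0..} \<epsilon>'"
    and "\<And>t. t \<ge> t\<^sub>0 \<Longrightarrow> (\<epsilon>' has_real_derivative \<epsilon>'' t) (at t within {t\<^sub>0..})"
    and "(\<epsilon> \<longlongrightarrow> 0) at_top"
    and "strong_global_solution A \<eta> \<delta> \<gamma> t\<^sub>0 \<epsilon> x"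
    and "\<gamma> < \<delta>" and "\<delta> < \<gamma> + \<gamma> / (\<gamma>\<^sup>2 / 2 + 1)"
    and "\<And>t. t \<ge> t\<^sub>0 \<Longrightarrow> \<epsilon> t powr (- 1 / 2) * \<epsilon>'' t \<le> - (1 / 4) * (\<delta> - \<gamma>) * \<epsilon>' t"
    and "((\<lambda>t. \<epsilon> t powr (- 2 - 1 / \<gamma>\<^sup>2) * \<epsilon>' t) \<longlongrightarrow> 0) at_top"
    and "filterlim (\<lambda>t. exp (integral {t\<^sub>0..t} (\<lambda>s. sqrt (\<epsilon> s)))) at_top at_top"
  shows "(x \<longlongrightarrow> (ARG_MIN norm z. z \<in> zer A)) at_top"
proof -
  have \<eta>: "\<eta> > 0" "\<rho> + \<eta> > 0" using assms(3) by auto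
  note yos = assms(1) \<eta>(2,1)
  have zer: "zer A = {z. yosida \<eta> A z = 0}" by (rule zer_eq_yosida_zero[OF yos])
  then obtain z where z: "yosida \<eta> A z = 0" using assms(2) by blast
  obtain v where v: "\<And>t. t \<ge> t\<^sub>0 \<Longrightarrow> (x has_vector_derivative v t) (at t within {t\<^sub>0..})"
    "loc_abs_continuous t\<^sub>0 v"
    and ae: "AE t in lebesgue. t \<ge> t\<^sub>0 \<longrightarrow>
             (\<exists>a w. (v has_vector_derivative a) (at t within {t\<^sub>0..}) \<and>
                    ((\<lambda>s. yosida \<eta> A (x s) + \<epsilon> s *\<^sub>R x s) has_vector_derivative w)
                      (at t within {t\<^sub>0..}) \<and>
                    a + (\<delta> * sqrt (\<epsilon> t)) *\<^sub>R v t + (1 / (\<gamma> * sqrt (\<epsilon> t))) *\<^sub>R w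
                      + yosida \<eta> A (x t) + \<epsilon> t *\<^sub>R x t = 0)"
    using assms(13) unfolding strong_global_solution_def by blast
  obtain N where N: "negligible N" and ode: "\<And>t. t \<notin> N \<Longrightarrow> t \<ge> t\<^sub>0 \<Longrightarrow>
             (\<exists>a w. (v has_vector_derivative a) (at t within {t\<^sub>0..}) \<and>
                    ((\<lambda>s. yosida \<eta> A (x s) + \<epsilon> s *\<^sub>R x s) has_vector_derivative w)
                      (at t within {t\<^sub>0..}) \<and>
                    a + (\<delta> * sqrt (\<epsilon> t)) *\<^sub>R v t + (1 / (\<gamma> * sqrt (\<epsilon> t))) *\<^sub>R w
                      + yosida \<eta> A (x t) + \<epsilon> t *\<^sub>R x t = 0)"
    by (rule AE_E3[OF ae]) (rule that, auto simp: negligible_iff_null_sets)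
  \<comment> \<open>Here \<open>\<gamma> < \<delta>\<close> makes the shift coefficient
    \<open>\<delta> - \<gamma>\<close> positive, and the damping factor
    \<open>\<gamma> + (\<delta> - \<gamma>)\<close> is \<open>\<delta>\<close>.\<close>
  interpret inertial_tikhonov_flow "yosida \<eta> A" "\<rho> + \<eta>" \<gamma> "\<delta> - \<gamma>" t\<^sub>0 \<epsilon> \<epsilon>' x v N z
  proof
    show "cocoercive (\<rho> + \<eta>) (yosida \<eta> A)" by (rule yosida_cocoercive[OF yos])
    have "\<forall>\<^sub>F t in at_top. \<epsilon> t > 0"
      using eventually_ge_at_top[of t\<^sub>0] by eventually_elim (rule assms(7))
    then show "((\<lambda>t. \<epsilon>' t / (\<epsilon> t)\<^sup>2) \<longlongrightarrow> 0) at_top"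
      by (rule powr_slow_imp_square_slow[OF _ assms(12) _ assms(17)]) simp
  qed (use \<eta> assms(5,7-10,12,14) v N z ode in \<open>simp_all\<close>)
  have "q = (\<lambda>s. sqrt (\<epsilon> s))" by (simp add: q_def fun_eq_iff)
  then show ?thesis using flow_tendsto_min_norm assms(18) by (simp add: zer)
qed

end
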